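(* Let $E$ be an Archimedean uniformly complete vector lattice. Then $E$ is prime Artinian if and only if it is lattice isomorphic to $c_{00}(\Omega)$ for some nonempty set $\Omega$.
   Context: A vector lattice $E$ with positive cone $E_+$ is Archimedean if $x,y\in E_+$ and $nx\le y$ for all $n\in\mathbb N$ imply $x=0$. An (order) ideal of a vector lattice $E$ is a linear subspace $I$ such that $|x|\le|y|$, $x\in E$, $y\in I$ imply $x\in I$. A proper ideal $P$ is prime if, for $x,y\in E$, $x\wedge y\in P$ implies $x\in P$ or $y\in P$. $E$ is prime Artinian if every decreasing sequence $(P_n)_{n\in\mathbb N}$ of prime ideals of $E$ is stationary (there is $k$ with $P_n=P_k$ for all $n\ge k$). A net $(x_\alpha)$ in $E$ converges relatively uniformly to $x$ with regulator $y\in E_+$ if for each $\varepsilon>0$ there is $\alpha_\varepsilon$ with $|x_\alpha-x|\le\varepsilon y$ for all $\alpha\ge\alpha_\varepsilon$; $E$ is (relatively) uniformly complete if every relatively uniformly Cauchy net converges relatively uniformly with respect to the same regulator. (For Archimedean $E$, equivalently: for each $x\in E_+$ the principal ideal $I_x$ generated by $x$ is complete in the norm $\|y\|_x=\inf\{\lambda>0: -\lambda x\le y\le\lambda x\}$.) $c_{00}(\Omega)$ is the vector lattice of all finitely supported functions $\Omega\to\mathbb R$ with the pointwise order.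
   Formalization: E is assumed to be nonzero: E = {0} is Archimedean, uniformly complete and vacuously prime Artinian (it has no proper ideals), but it is not isomorphic to c_00(Ω) for any nonempty Ω. *)

theory Defs
  imports "HOL-Analysis.Analysis" "HOL-Library.Lattice_Algebras"
begin

text \<open>The class \<^class>\<open>lattice_ab_group_add_abs\<close> only adds the modulus
  \<open>\<bar>x\<bar> = sup x (- x)\<close> to a lattice-ordered abelian group.\<close>

class vector_lattice = ordered_real_vector + lattice_ab_group_add_abs

definition archimedean :: "'a::vector_lattice itself \<Rightarrow> bool" where
  "archimedean _ \<longleftrightarrow>
     (\<forall>x y :: 'a. 0 \<le> x \<longrightarrow> 0 \<le> y \<longrightarrow> (\<forall>n::nat. real n *\<^sub>R x \<le> y) \<longrightarrow> x = 0)"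

definition order_ideal :: "'a::vector_lattice set \<Rightarrow> bool" where
  "order_ideal I \<longleftrightarrow> subspace I \<and> (\<forall>x y. \<bar>x\<bar> \<le> \<bar>y\<bar> \<longrightarrow> y \<in> I \<longrightarrow> x \<in> I)"

definition prime_order_ideal :: "'a::vector_lattice set \<Rightarrow> bool" where
  "prime_order_ideal P \<longleftrightarrow>
     order_ideal P \<and> P \<noteq> UNIV \<and> (\<forall>x y. inf x y \<in> P \<longrightarrow> x \<in> P \<or> y \<in> P)"

definition prime_artinian :: "'a::vector_lattice itself \<Rightarrow> bool" where
  "prime_artinian _ \<longleftrightarrow>
     (\<forall>P :: nat \<Rightarrow> 'a set. (\<forall>n. prime_order_ideal (P n)) \<longrightarrow> decseq P \<longrightarrow>
        (\<exists>k. \<forall>n\<ge>k. P n = P k))"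


text \<open>A net is a family \<open>x\<close> restricted to an index set \<open>A\<close> that is directed by a preorder
  \<open>le\<close>.\<close>

definition directed_by :: "'i set \<Rightarrow> ('i \<Rightarrow> 'i \<Rightarrow> bool) \<Rightarrow> bool" where
  "directed_by A le \<longleftrightarrow> A \<noteq> {} \<and> reflp_on A le \<and> transp_on A le \<and>
     (\<forall>a\<in>A. \<forall>b\<in>A. \<exists>c\<in>A. le a c \<and> le b c)"

definition ru_converges ::
  "'i set \<Rightarrow> ('i \<Rightarrow> 'i \<Rightarrow> bool) \<Rightarrow> ('i \<Rightarrow> 'a::vector_lattice) \<Rightarrow> 'a \<Rightarrow> 'a \<Rightarrow> bool" where
  "ru_converges A le x l y \<longleftrightarrow>
     (\<forall>\<epsilon>>0. \<exists>a\<in>A. \<forall>b\<in>A. le a b \<longrightarrow> \<bar>x b - l\<bar> \<le> \<epsilon> *\<^sub>R y)"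

definition ru_cauchy ::
  "'i set \<Rightarrow> ('i \<Rightarrow> 'i \<Rightarrow> bool) \<Rightarrow> ('i \<Rightarrow> 'a::vector_lattice) \<Rightarrow> 'a \<Rightarrow> bool" where
  "ru_cauchy A le x y \<longleftrightarrow>
     (\<forall>\<epsilon>>0. \<exists>a\<in>A. \<forall>b\<in>A. \<forall>c\<in>A. le a b \<longrightarrow> le a c \<longrightarrow> \<bar>x b - x c\<bar> \<le> \<epsilon> *\<^sub>R y)"

text \<open>A formula cannot quantify over all index types.  The index type \<^typ>\<open>'a \<times> 'a set\<close> is large
  enough: an arbitrary net can be reindexed by the pairs consisting of a tail and a point of
  that tail.  Lemma \<open>uniformly_complete_net\<close> below gives completeness for nets over
  every index type.\<close>

definition uniformly_complete :: "'a::vector_lattice itself \<Rightarrow> bool" where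
  "uniformly_complete _ \<longleftrightarrow>
     (\<forall>(A :: ('a \<times> 'a set) set) le (x :: 'a \<times> 'a set \<Rightarrow> 'a) y.
        directed_by A le \<longrightarrow> 0 \<le> y \<longrightarrow> ru_cauchy A le x y \<longrightarrow> (\<exists>l. ru_converges A le x l y))"

lemma uniformly_complete_net:
  fixes A :: "'i set" and x :: "'i \<Rightarrow> 'a::vector_lattice"
  assumes uc: "uniformly_complete TYPE('a)"
    and dir: "directed_by A le" and y: "0 \<le> y" and cau: "ru_cauchy A le x y"
  shows "\<exists>l. ru_converges A le x l y"
proof -
  define tail where "tail a = x ` {b\<in>A. le a b}" for a
  define B where "B = {(v, S). \<exists>a\<in>A. S = tail a \<and> v \<in> S}"
  define leB where "leB p q \<longleftrightarrow> snd q \<subseteq> snd p" for p q :: "'a \<times> 'a set"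
  have refl: "le a a" if "a \<in> A" for a
    using dir that by (auto simp: directed_by_def reflp_on_def)
  have trans: "le a c" if "a \<in> A" "b \<in> A" "c \<in> A" "le a b" "le b c" for a b c
    using dir that unfolding directed_by_def transp_on_def by blast
  have inB: "(x a, tail a) \<in> B" if "a \<in> A" for a
    using that refl[OF that] by (auto simp: B_def tail_def)
  have tail_mono: "tail b \<subseteq> tail a" if "a \<in> A" "b \<in> A" "le a b" for a b
    using that(2) trans[OF that(1,2) _ that(3)] by (auto simp: tail_def)
  have "directed_by B leB"
    unfolding directed_by_def
  proof (intro conjI ballI)
    show "B \<noteq> {}" using dir inB by (auto simp: directed_by_def)
    show "reflp_on B leB" by (auto simp: reflp_on_def leB_def)
    show "transp_on B leB" by (auto simp: transp_on_def leB_def)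
    fix p q assume "p \<in> B" "q \<in> B"
    then obtain a b where ab: "a \<in> A" "b \<in> A" "snd p = tail a" "snd q = tail b"
      by (auto simp: B_def)
    then obtain c where c: "c \<in> A" "le a c" "le b c"
      using dir unfolding directed_by_def by blast
    show "\<exists>r\<in>B. leB p r \<and> leB q r"
      using inB[OF c(1)] tail_mono[OF ab(1) c(1,2)] tail_mono[OF ab(2) c(1,3)] ab
      by (intro bexI[of _ "(x c, tail c)"]) (auto simp: leB_def)
  qed
  moreover have "ru_cauchy B leB fst y"
    unfolding ru_cauchy_def
  proof (intro allI impI)
    fix \<epsilon> :: real assume "\<epsilon> > 0"
    then obtain a where a: "a \<in> A"
        "\<And>b c. b \<in> A \<Longrightarrow> c \<in> A \<Longrightarrow> le a b \<Longrightarrow> le a c \<Longrightarrow> \<bar>x b - x c\<bar> \<le> \<epsilon> *\<^sub>R y"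
      using cau unfolding ru_cauchy_def by blast
    have in_tail: "fst p \<in> tail a" if "p \<in> B" "leB (x a, tail a) p" for p
      using that by (auto simp: B_def leB_def)
    show "\<exists>p\<in>B. \<forall>q\<in>B. \<forall>r\<in>B. leB p q \<longrightarrow> leB p r \<longrightarrow> \<bar>fst q - fst r\<bar> \<le> \<epsilon> *\<^sub>R y"
    proof (intro bexI[OF _ inB[OF a(1)]] ballI impI)
      fix q r assume "q \<in> B" "r \<in> B" "leB (x a, tail a) q" "leB (x a, tail a) r"
      then have "fst q \<in> tail a" "fst r \<in> tail a" using in_tail by blast+
      then show "\<bar>fst q - fst r\<bar> \<le> \<epsilon> *\<^sub>R y" using a(2) by (auto simp: tail_def)
    qed
  qed
  ultimately obtain l where l: "ru_converges B leB fst l y"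
    using uc y unfolding uniformly_complete_def by blast
  have "ru_converges A le x l y"
    unfolding ru_converges_def
  proof (intro allI impI)
    fix \<epsilon> :: real assume "\<epsilon> > 0"
    then obtain p where p: "p \<in> B" "\<And>q. q \<in> B \<Longrightarrow> leB p q \<Longrightarrow> \<bar>fst q - l\<bar> \<le> \<epsilon> *\<^sub>R y"
      using l unfolding ru_converges_def by blast
    then obtain a where a: "a \<in> A" "snd p = tail a" by (auto simp: B_def)
    show "\<exists>a\<in>A. \<forall>b\<in>A. le a b \<longrightarrow> \<bar>x b - l\<bar> \<le> \<epsilon> *\<^sub>R y"
    proof (intro bexI[OF _ a(1)] ballI impI)
      fix b assume b: "b \<in> A" "le a b"
      then have "leB p (x b, tail b)" using tail_mono[OF a(1) b] a by (simp add: leB_def)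
      then show "\<bar>x b - l\<bar> \<le> \<epsilon> *\<^sub>R y" using p(2)[OF inB[OF b(1)]] by simp
    qed
  qed
  then show ?thesis by blast
qed


text \<open>Functions on the set \<open>\<Omega>\<close> are represented by their extension by zero to the whole type.\<close>

definition c00 :: "'b set \<Rightarrow> ('b \<Rightarrow> real) set" where
  "c00 \<Omega> = {f. finite {w. f w \<noteq> 0} \<and> (\<forall>w. w \<notin> \<Omega> \<longrightarrow> f w = 0)}"

definition lattice_iso_c00 :: "'b set \<Rightarrow> ('a::vector_lattice \<Rightarrow> 'b \<Rightarrow> real) \<Rightarrow> bool" where
  "lattice_iso_c00 \<Omega> T \<longleftrightarrow> bij_betw T UNIV (c00 \<Omega>) \<and>
     (\<forall>x y. T (x + y) = (\<lambda>w. T x w + T y w)) \<and>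
     (\<forall>r x. T (r *\<^sub>R x) = (\<lambda>w. r * T x w)) \<and>
     (\<forall>x y. T (sup x y) = (\<lambda>w. max (T x w) (T y w))) \<and>
     (\<forall>x y. T (inf x y) = (\<lambda>w. min (T x w) (T y w)))"

text \<open>The points of \<open>\<Omega>\<close> embed into \<^term>\<open>c00 \<Omega>\<close> as indicator functions; hence a set \<open>\<Omega>\<close> of any
  type may be replaced by a set of elements of the vector lattice itself.\<close>

lemma lattice_iso_c00_retype:
  fixes T :: "'a::vector_lattice \<Rightarrow> 'b \<Rightarrow> real" and \<Omega> :: "'b set"
  assumes iso: "lattice_iso_c00 \<Omega> T" and ne: "\<Omega> \<noteq> {}"
  shows "\<exists>(\<Omega>' :: 'a set) T'. \<Omega>' \<noteq> {} \<and> lattice_iso_c00 \<Omega>' (T' :: 'a \<Rightarrow> 'a \<Rightarrow> real)"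
proof -
  have bij: "bij_betw T UNIV (c00 \<Omega>)" using iso by (simp add: lattice_iso_c00_def)
  define ind where "ind w = (\<lambda>v. if v = w then 1 else 0 :: real)" for w :: 'b
  define g where "g w = inv T (ind w)" for w
  have ind: "ind w \<in> c00 \<Omega>" if "w \<in> \<Omega>" for w
    using that by (auto simp: c00_def ind_def)
  have Tg: "T (g w) = ind w" if "w \<in> \<Omega>" for w
    using bij ind[OF that] unfolding g_def by (metis bij_betw_def f_inv_into_f)
  have inj: "inj_on g \<Omega>"
  proof (rule inj_onI)
    fix v w assume "v \<in> \<Omega>" "w \<in> \<Omega>" "g v = g w"
    then have "ind v = ind w" using Tg by metis
    then have "ind v v = ind w v" by simp
    then show "v = w" by (auto simp: ind_def split: if_splits)
  qed
  define h where "h = inv_into \<Omega> g"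
  have hg: "h (g w) = w" if "w \<in> \<Omega>" for w using inj that by (simp add: h_def)
  define R where "R f = (\<lambda>a. if a \<in> g ` \<Omega> then f (h a) else 0 :: real)" for f
  have "bij_betw R (c00 \<Omega>) (c00 (g ` \<Omega>))"
  proof (rule bij_betw_byWitness[where f' = "\<lambda>k w. if w \<in> \<Omega> then k (g w) else 0"])
    show "\<forall>f\<in>c00 \<Omega>. (\<lambda>w. if w \<in> \<Omega> then R f (g w) else 0) = f"
      by (auto simp: R_def c00_def hg fun_eq_iff)
    show "\<forall>k\<in>c00 (g ` \<Omega>). R (\<lambda>w. if w \<in> \<Omega> then k (g w) else 0) = k"
      by (auto simp: R_def c00_def hg fun_eq_iff)
    show "R ` c00 \<Omega> \<subseteq> c00 (g ` \<Omega>)"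
    proof
      fix k assume "k \<in> R ` c00 \<Omega>"
      then obtain f where f: "f \<in> c00 \<Omega>" "k = R f" by blast
      have "{a. R f a \<noteq> 0} \<subseteq> g ` {w. f w \<noteq> 0}" by (auto simp: R_def hg)
      then have "finite {a. R f a \<noteq> 0}"
        using f by (auto simp: c00_def intro: finite_subset)
      then show "k \<in> c00 (g ` \<Omega>)" using f by (auto simp: c00_def R_def)
    qed
    show "(\<lambda>k w. if w \<in> \<Omega> then k (g w) else 0) ` c00 (g ` \<Omega>) \<subseteq> c00 \<Omega>"
    proof
      fix f assume "f \<in> (\<lambda>k w. if w \<in> \<Omega> then k (g w) else 0) ` c00 (g ` \<Omega>)"
      then obtain k where k: "k \<in> c00 (g ` \<Omega>)" "f = (\<lambda>w. if w \<in> \<Omega> then k (g w) else 0)"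
        by blast
      have "{w. f w \<noteq> 0} \<subseteq> h ` {a. k a \<noteq> 0}"
      proof
        fix w assume "w \<in> {w. f w \<noteq> 0}"
        then have "w \<in> \<Omega>" "k (g w) \<noteq> 0" using k by (auto split: if_splits)
        then show "w \<in> h ` {a. k a \<noteq> 0}" using hg by (metis (mono_tags) image_eqI mem_Collect_eq)
      qed
      then have "finite {w. f w \<noteq> 0}"
        using k(1) by (auto simp: c00_def intro: finite_subset)
      then show "f \<in> c00 \<Omega>" using k by (auto simp: c00_def)
    qed
  qed
  then have "bij_betw (R \<circ> T) UNIV (c00 (g ` \<Omega>))" using bij bij_betw_trans by blast
  then have "lattice_iso_c00 (g ` \<Omega>) (R \<circ> T)"
    using iso by (auto simp: lattice_iso_c00_def R_def fun_eq_iff)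
  then show ?thesis
    using ne by (intro exI[of _ "g ` \<Omega>"] exI[of _ "R \<circ> T"] conjI) simp_all
qed

end

theory Submission
  imports Defs
begin

text \<open>An infinite sequence of pairwise disjoint elements \<open>e n > 0\<close> below some \<open>x\<close> would give, by uniform
  completeness, elements \<open>f k = (\<Sum>n. 2^(- n (k + 1)) *\<^sub>R e n)\<close> that decrease so fast that, modulo a
  suitable prime ideal \<open>P\<close> containing all \<open>e n\<close> and no \<open>f k\<close>, each is infinitely small compared to
  the previous one; then the ideals generated by \<open>P\<close> and \<open>f k\<close> are a strictly decreasing sequence of
  prime ideals.  Hence in a prime Artinian lattice order bounded disjoint sets are finite.  By the
  Archimedean property there is then an atom below each positive element, and subtracting the
  largest possible multiples of finitely many atoms leaves nothing: a maximal disjoint set of atoms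
  is a basis in which the order is coordinatewise.  Conversely, the prime ideals of
  \<open>c\<^sub>0\<^sub>0(\<Omega>)\<close> are the kernels of the point evaluations, which are pairwise incomparable.\<close>

section \<open>Scalar multiples, disjointness and the Archimedean property\<close>

lemma abs_scaleR_le: "\<bar>c *\<^sub>R x\<bar> \<le> \<bar>c\<bar> *\<^sub>R \<bar>x :: 'a::vector_lattice\<bar>"
proof -
  have "c *\<^sub>R x \<le> c *\<^sub>R \<bar>x\<bar>" "- (c *\<^sub>R x) \<le> c *\<^sub>R \<bar>x\<bar>" if "0 \<le> c" for c and x :: 'a
    using that scaleR_left_mono[OF abs_ge_self[of x]] scaleR_left_mono[OF abs_ge_minus_self[of x]]
    by simp_all
  from this[of "\<bar>c\<bar>" x] show ?thesis
    by (cases "0 \<le> c") (auto intro!: abs_leI)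
qed

text \<open>The infimum is at most \<open>inf a b + c = c\<close>; being also below
  \<open>a\<close>, it lies below \<open>inf a c = 0\<close>.\<close>

lemma inf_add_eq_zero:
  fixes a b c :: "'a::vector_lattice"
  assumes "0 \<le> a" "0 \<le> b" "0 \<le> c" "inf a b = 0" "inf a c = 0"
  shows "inf a (b + c) = 0"
proof (rule antisym)
  have "inf a (b + c) \<le> inf (a + c) (b + c)"
    using assms by (intro inf_mono) (simp_all add: add_increasing2)
  also have "\<dots> = inf a b + c" by (rule add_inf_distrib_right[symmetric])
  finally have "inf a (b + c) \<le> c" using assms by simp
  then show "inf a (b + c) \<le> 0" using assms by (metis inf.cobounded1 le_inf_iff)
qed (use assms in simp)

text \<open>A common bound \<open>m\<close> of both scalars puts the infimum below \<open>m\<close>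
  times \<open>a\<close> and \<open>m\<close> times \<open>b\<close>. Dividing by \<open>m\<close>
  leaves an element below \<open>inf a b = 0\<close>.\<close>

lemma inf_scaleR_eq_zero:
  fixes a b :: "'a::vector_lattice"
  assumes "0 \<le> a" "0 \<le> b" "inf a b = 0" "0 \<le> s" "0 \<le> t"
  shows "inf (s *\<^sub>R a) (t *\<^sub>R b) = 0"
proof (rule antisym)
  \<comment> \<open>The summand 1 keeps \<open>m\<close> positive, hence invertible, when
    \<open>s\<close> and \<open>t\<close> are both 0.\<close>
  define m where "m = max s t + 1"
  have m: "0 < m" "s \<le> m" "t \<le> m" using assms by (auto simp: m_def)
  let ?w = "inf (s *\<^sub>R a) (t *\<^sub>R b)"
  have "?w \<le> m *\<^sub>R a" "?w \<le> m *\<^sub>R b"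
    using scaleR_right_mono[OF m(2) assms(1)] scaleR_right_mono[OF m(3) assms(2)]
    by (auto intro: le_infI1 le_infI2)
  then have "inverse m *\<^sub>R ?w \<le> a" "inverse m *\<^sub>R ?w \<le> b"
    using m scaleR_left_mono[of ?w _ "inverse m"] by fastforce+
  then have "inverse m *\<^sub>R ?w \<le> 0" using assms(3) by (metis le_inf_iff)
  then have "m *\<^sub>R inverse m *\<^sub>R ?w \<le> m *\<^sub>R 0" using m by (intro scaleR_left_mono) auto
  then show "?w \<le> 0" using m by simp
qed (use assms in \<open>simp add: scaleR_nonneg_nonneg\<close>)

lemma inf_sum_eq_zero:
  fixes a :: "'a::vector_lattice"
  assumes "0 \<le> a" "\<And>i. i \<in> F \<Longrightarrow> 0 \<le> b i" "\<And>i. i \<in> F \<Longrightarrow> inf a (b i) = 0"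
  shows "inf a (sum b F) = 0"
  using assms(2,3)
proof (induction F rule: infinite_finite_induct)
  case (insert i F)
  then show ?case using assms(1) by (simp add: inf_add_eq_zero sum_nonneg)
qed (use assms(1) in \<open>simp_all add: inf_absorb2\<close>)

lemma inf_eq_zero_mono:
  fixes a b :: "'a::vector_lattice"
  assumes "inf a b = 0" "0 \<le> u" "u \<le> a" "0 \<le> v" "v \<le> b"
  shows "inf u v = 0"
  using inf_mono[OF assms(3,5)] assms by (simp add: antisym)

text \<open>With \<epsilon> = 1/n, every natural multiple of the positive part of
  \<open>x - z\<close> is below \<open>y\<close>, so this part vanishes. The lemma serves as the
  passage to the limit \<epsilon> -> 0 in all later estimates.\<close>

lemma archimedean_le:
  fixes x y z :: "'a::vector_lattice"
  assumes arch: "archimedean TYPE('a)" and y: "0 \<le> y"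
    and le: "\<And>\<epsilon>. 0 < \<epsilon> \<Longrightarrow> x \<le> z + \<epsilon> *\<^sub>R y"
  shows "x \<le> z"
proof -
  let ?d = "sup (x - z) 0"
  have d: "?d \<le> \<epsilon> *\<^sub>R y" if "0 < \<epsilon>" for \<epsilon>
    using le[OF that] that y by (simp add: diff_le_eq add.commute scaleR_nonneg_nonneg)
  have "real n *\<^sub>R ?d \<le> y" for n
  proof (cases "n = 0")
    case False
    then have "real n *\<^sub>R ?d \<le> real n *\<^sub>R (1 / real n) *\<^sub>R y"
      by (intro scaleR_left_mono d) auto
    then show ?thesis using False by simp
  qed (use y in simp)
  then have "?d = 0"
    using arch y unfolding archimedean_def by (metis sup.cobounded2)
  then show ?thesis by (metis diff_le_0_iff_le sup.cobounded1)
qed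

section \<open>Order ideals, prime ideals and separation\<close>

lemma order_ideal_subspace: "order_ideal I \<Longrightarrow> subspace I"
  by (simp add: order_ideal_def)

lemma order_ideal_abs_le:
  assumes "order_ideal I" "y \<in> I" "\<bar>x\<bar> \<le> y"
  shows "x \<in> I"
proof -
  have "\<bar>x\<bar> \<le> \<bar>y\<bar>" using assms(3) abs_ge_self by (rule order_trans)
  then show ?thesis using assms unfolding order_ideal_def by blast
qed

lemma order_ideal_le: "order_ideal I \<Longrightarrow> y \<in> I \<Longrightarrow> 0 \<le> x \<Longrightarrow> x \<le> y \<Longrightarrow> x \<in> I"
  by (rule order_ideal_abs_le) simp_all

lemma order_ideal_abs:
  assumes "order_ideal I" "x \<in> I"
  shows "\<bar>x\<bar> \<in> I"
proof -
  have "\<bar>\<bar>x\<bar>\<bar> \<le> \<bar>x\<bar>" by simp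
  then show ?thesis using assms unfolding order_ideal_def by blast
qed

lemma order_idealI:
  assumes "0 \<in> I" "\<And>x y. x \<in> I \<Longrightarrow> y \<in> I \<Longrightarrow> x + y \<in> I"
    "\<And>c x. x \<in> I \<Longrightarrow> c *\<^sub>R x \<in> I" "\<And>x y. \<bar>x\<bar> \<le> \<bar>y\<bar> \<Longrightarrow> y \<in> I \<Longrightarrow> x \<in> I"
  shows "order_ideal I"
  using assms by (auto simp: order_ideal_def subspace_def)

text \<open>Subtracting \<open>inf x y\<close> from \<open>x\<close> and from \<open>y\<close> makes
  them disjoint, and changes neither membership when \<open>inf x y\<close> lies in
  \<open>Q\<close>. So primeness need only be tested on disjoint pairs.\<close>

lemma prime_order_idealI:
  assumes "order_ideal Q" "Q \<noteq> UNIV" "\<And>x y. inf x y = 0 \<Longrightarrow> x \<in> Q \<or> y \<in> Q"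
  shows "prime_order_ideal Q"
  unfolding prime_order_ideal_def
proof (intro conjI allI impI)
  fix x y assume z: "inf x y \<in> Q"
  have "inf (x - inf x y) (y - inf x y) = 0"
    using add_inf_distrib_right[of x y "- inf x y", symmetric]
    unfolding add_uminus_conv_diff diff_self .
  from assms(3)[OF this] show "x \<in> Q \<or> y \<in> Q"
    using subspace_add[OF order_ideal_subspace[OF assms(1)] _ z] by (metis diff_add_cancel)
qed (use assms in auto)

text \<open>For an order ideal \<open>P\<close> and \<open>0 \<le> f\<close> this is the order ideal
  generated by \<open>P\<close> and \<open>f\<close>.\<close>

definition ideal_adjoin :: "'a::vector_lattice set \<Rightarrow> 'a \<Rightarrow> 'a set" where
  "ideal_adjoin P f = {x. \<exists>p\<in>P. \<exists>k\<ge>0. \<bar>x\<bar> \<le> p + k *\<^sub>R f}"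

lemma order_ideal_adjoin:
  assumes P: "order_ideal P"
  shows "order_ideal (ideal_adjoin P f)"
proof (rule order_idealI)
  show "0 \<in> ideal_adjoin P f"
    using subspace_0[OF order_ideal_subspace[OF P]] unfolding ideal_adjoin_def by force
next
  fix x y assume "x \<in> ideal_adjoin P f" "y \<in> ideal_adjoin P f"
  then obtain p k q l where *: "p \<in> P" "k \<ge> 0" "\<bar>x\<bar> \<le> p + k *\<^sub>R f" "q \<in> P" "l \<ge> 0" "\<bar>y\<bar> \<le> q + l *\<^sub>R f"
    unfolding ideal_adjoin_def by blast
  have "\<bar>x + y\<bar> \<le> (p + q) + (k + l) *\<^sub>R f"
    using order_trans[OF abs_triangle_ineq add_mono[OF *(3,6)]] by (simp add: algebra_simps)
  then show "x + y \<in> ideal_adjoin P f"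
    using * subspace_add[OF order_ideal_subspace[OF P]] unfolding ideal_adjoin_def
    by (intro CollectI bexI[of _ "p + q"] exI[of _ "k + l"]) auto
next
  fix c x assume "x \<in> ideal_adjoin P f"
  then obtain p k where *: "p \<in> P" "k \<ge> 0" "\<bar>x\<bar> \<le> p + k *\<^sub>R f"
    unfolding ideal_adjoin_def by blast
  have "\<bar>c *\<^sub>R x\<bar> \<le> \<bar>c\<bar> *\<^sub>R (p + k *\<^sub>R f)"
    using order_trans[OF abs_scaleR_le scaleR_left_mono[OF *(3)]] by simp
  then show "c *\<^sub>R x \<in> ideal_adjoin P f"
    using * subspace_scale[OF order_ideal_subspace[OF P]] unfolding ideal_adjoin_def
    by (intro CollectI bexI[of _ "\<bar>c\<bar> *\<^sub>R p"] exI[of _ "\<bar>c\<bar> * k"]) (auto simp: algebra_simps)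
next
  fix x y assume xy: "\<bar>x\<bar> \<le> \<bar>y\<bar>" and "y \<in> ideal_adjoin P f"
  then obtain p k where "p \<in> P" "k \<ge> 0" "\<bar>y\<bar> \<le> p + k *\<^sub>R f"
    unfolding ideal_adjoin_def by blast
  with order_trans[OF xy] show "x \<in> ideal_adjoin P f"
    unfolding ideal_adjoin_def by blast
qed

lemma subset_ideal_adjoin: "order_ideal P \<Longrightarrow> P \<subseteq> ideal_adjoin P f"
  unfolding ideal_adjoin_def by (force dest: order_ideal_abs)

lemma in_ideal_adjoin:
  assumes "order_ideal P" "0 \<le> f"
  shows "f \<in> ideal_adjoin P f"
  unfolding ideal_adjoin_def using subspace_0[OF order_ideal_subspace[OF assms(1)]] assms(2)
  by (intro CollectI bexI[of _ 0] exI[of _ 1]) auto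

lemma ideal_adjoin_mono:
  assumes "f \<le> g"
  shows "ideal_adjoin P f \<subseteq> ideal_adjoin P g"
proof
  fix x assume "x \<in> ideal_adjoin P f"
  then obtain p k where *: "p \<in> P" "k \<ge> 0" "\<bar>x\<bar> \<le> p + k *\<^sub>R f"
    unfolding ideal_adjoin_def by blast
  note *(3)
  also have "p + k *\<^sub>R f \<le> p + k *\<^sub>R g"
    using scaleR_left_mono[OF assms *(2)] by simp
  finally show "x \<in> ideal_adjoin P g"
    using * unfolding ideal_adjoin_def by blast
qed

text \<open>Zorn's lemma gives an ideal \<open>P\<close> maximal among those that contain
  \<open>I\<close> and miss \<open>S\<close>. If disjoint \<open>x\<close> and \<open>y\<close> were
  both outside \<open>P\<close>, the ideals obtained by adjoining \<open>x\<close> and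
  \<open>y\<close> would both meet \<open>S\<close>. As \<open>S\<close> is directed downwards, some
  \<open>u\<close> in \<open>S\<close> would lie below an element of \<open>P\<close> plus a
  multiple of \<open>x\<close>, and likewise for \<open>y\<close>; disjointness then forces
  \<open>u\<close> into \<open>P\<close>.\<close>

lemma prime_ideal_separation:
  fixes I S :: "'a::vector_lattice set"
  assumes I: "order_ideal I" "I \<inter> S = {}" and ne: "S \<noteq> {}"
    and pos: "\<And>s. s \<in> S \<Longrightarrow> 0 \<le> s"
    and down: "\<And>s t. s \<in> S \<Longrightarrow> t \<in> S \<Longrightarrow> \<exists>u\<in>S. u \<le> s \<and> u \<le> t"
  obtains P where "prime_order_ideal P" "I \<subseteq> P" "P \<inter> S = {}"
proof -
  let ?A = "{J. order_ideal J \<and> I \<subseteq> J \<and> J \<inter> S = {}}"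
  have "\<exists>P\<in>?A. \<forall>J\<in>?A. P \<subseteq> J \<longrightarrow> J = P"
  proof (rule subset_Zorn_nonempty)
    show "?A \<noteq> {}" using I by blast
    fix C assume C: "C \<noteq> {}" "subset.chain ?A C"
    then have ideal: "order_ideal J" if "J \<in> C" for J
      using that by (auto simp: subset_chain_def)
    have "order_ideal (\<Union>C)"
    proof (rule order_idealI)
      show "0 \<in> \<Union>C" using C(1) ideal subspace_0[OF order_ideal_subspace] by blast
    next
      fix x y assume "x \<in> \<Union>C" "y \<in> \<Union>C"
      then obtain J where "J \<in> C" "x \<in> J" "y \<in> J"
        using C(2) unfolding subset_chain_def by blast
      then show "x + y \<in> \<Union>C"
        using subspace_add[OF order_ideal_subspace[OF ideal]] by blast
    next
      fix c x assume "x \<in> \<Union>C"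
      then show "c *\<^sub>R x \<in> \<Union>C" using subspace_scale[OF order_ideal_subspace[OF ideal]] by blast
    next
      fix x y :: 'a assume "\<bar>x\<bar> \<le> \<bar>y\<bar>" "y \<in> \<Union>C"
      then show "x \<in> \<Union>C" using ideal unfolding order_ideal_def by blast
    qed
    then show "\<Union>C \<in> ?A" using C by (auto simp: subset_chain_def)
  qed
  then obtain P where "P \<in> ?A" and max': "\<forall>J\<in>?A. P \<subseteq> J \<longrightarrow> J = P" ..
  then have P: "order_ideal P" "I \<subseteq> P" "P \<inter> S = {}" by auto
  have max: "J = P" if "order_ideal J" "P \<subseteq> J" "J \<inter> S = {}" for J
    using max' that P(2) by auto
  have meets: "\<exists>s\<in>S. \<exists>p\<in>P. \<exists>k\<ge>0. s \<le> p + k *\<^sub>R x" if "0 \<le> x" "x \<notin> P" for x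
  proof -
    have "ideal_adjoin P x \<inter> S \<noteq> {}"
      using max[OF order_ideal_adjoin[OF P(1)] subset_ideal_adjoin[OF P(1)]]
        in_ideal_adjoin[OF P(1) that(1)] that(2) by blast
    then obtain s p k where "s \<in> S" "p \<in> P" "k \<ge> 0" "\<bar>s\<bar> \<le> p + k *\<^sub>R x"
      unfolding ideal_adjoin_def by blast
    then show ?thesis using order_trans[OF abs_ge_self] by blast
  qed
  have "prime_order_ideal P"
  proof (rule prime_order_idealI)
    show "P \<noteq> UNIV" using P(3) ne by blast
    fix x y :: 'a assume xy: "inf x y = 0"
    then have pos': "0 \<le> x" "0 \<le> y" by (metis inf.cobounded1, metis inf.cobounded2)
    show "x \<in> P \<or> y \<in> P"
    proof (rule ccontr)
      assume "\<not> ?thesis"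
      then have "x \<notin> P" "y \<notin> P" by simp_all
      with meets[OF pos'(1)] meets[OF pos'(2)]
      obtain s t p q k l where *: "s \<in> S" "p \<in> P" "k \<ge> 0" "s \<le> p + k *\<^sub>R x"
          "t \<in> S" "q \<in> P" "l \<ge> 0" "t \<le> q + l *\<^sub>R y"
        by blast
      obtain u where u: "u \<in> S" "u \<le> s" "u \<le> t" using down *(1,5) by blast
      \<comment> \<open>The elements \<open>p\<close> and \<open>q\<close> may have any sign; the
        sum of their moduli is an element of \<open>P\<close> above both.\<close>
      let ?r = "\<bar>p\<bar> + \<bar>q\<bar>"
      have "p \<le> ?r" "q \<le> ?r"
        using add_mono[OF abs_ge_self[of p] abs_ge_zero[of q]]
          add_mono[OF abs_ge_zero[of p] abs_ge_self[of q]] by simp_all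
      then have "u \<le> ?r + k *\<^sub>R x" "u \<le> ?r + l *\<^sub>R y"
        using order_trans[OF u(2) order_trans[OF *(4) add_right_mono]]
          order_trans[OF u(3) order_trans[OF *(8) add_right_mono]] by simp_all
      then have "u \<le> ?r + inf (k *\<^sub>R x) (l *\<^sub>R y)"
        by (simp add: add_inf_distrib_left)
      then have "u \<le> ?r" using inf_scaleR_eq_zero[OF pos' xy *(3,7)] by simp
      moreover have "?r \<in> P"
        using * P(1) order_ideal_abs subspace_add[OF order_ideal_subspace[OF P(1)]] by blast
      ultimately have "u \<in> P" using order_ideal_le[OF P(1)] pos u(1) by blast
      then show False using u(1) P(3) by blast
    qed
  qed (rule P(1))
  then show thesis using that P by blast
qed

text \<open>Modulo \<open>P\<close>, each \<open>f (Suc n)\<close> is infinitely small compared to \<open>f n\<close>, so that the ideals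
  generated by \<open>P\<close> and \<open>f n\<close> are strictly decreasing; they are prime because they contain \<open>P\<close>.\<close>

lemma not_prime_artinian_if_infinitesimals:
  fixes P :: "'a::vector_lattice set" and f :: "nat \<Rightarrow> 'a"
  assumes P: "prime_order_ideal P"
    and pos: "\<And>n. 0 \<le> f n" and notin: "\<And>n. f n \<notin> P" and dec: "\<And>n. f (Suc n) \<le> f n"
    and small: "\<And>n m. \<exists>p\<in>P. real m *\<^sub>R f (Suc n) \<le> f n + p"
  shows "\<not> prime_artinian TYPE('a)"
proof
  assume pa: "prime_artinian TYPE('a)"
  have oi: "order_ideal P" using P by (simp add: prime_order_ideal_def)
  define Q where "Q n = ideal_adjoin P (f (Suc n))" for n
  have fnotin: "f n \<notin> Q n" for n
  proof
    assume "f n \<in> Q n"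
    then obtain p k where p: "p \<in> P" "k \<ge> 0" "\<bar>f n\<bar> \<le> p + k *\<^sub>R f (Suc n)"
      unfolding Q_def ideal_adjoin_def by blast
    \<comment> \<open>The factor 2 leaves room for cancellation: twice \<open>f n\<close> is at most
      \<open>f n\<close> plus an element of \<open>P\<close>, so \<open>f n\<close> itself is below
      an element of \<open>P\<close>.\<close>
    obtain m where m: "2 * k \<le> real m" using real_arch_simple by blast
    obtain q where q: "q \<in> P" "real m *\<^sub>R f (Suc n) \<le> f n + q" using small by blast
    have "2 *\<^sub>R f n \<le> 2 *\<^sub>R (p + k *\<^sub>R f (Suc n))"
      using p(3) pos[of n] by (intro scaleR_left_mono) auto
    also have "\<dots> = 2 *\<^sub>R p + (2 * k) *\<^sub>R f (Suc n)" by (simp add: algebra_simps)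
    also have "\<dots> \<le> 2 *\<^sub>R p + real m *\<^sub>R f (Suc n)"
      using scaleR_right_mono[OF m pos] by simp
    also have "\<dots> \<le> 2 *\<^sub>R p + (f n + q)" using q(2) by simp
    finally have "f n \<le> 2 *\<^sub>R p + q" by (simp add: scaleR_2 algebra_simps)
    moreover have "2 *\<^sub>R p + q \<in> P"
      using order_ideal_subspace[OF oi] p q by (simp add: subspace_add subspace_scale)
    ultimately show False using order_ideal_le[OF oi _ pos] notin by blast
  qed
  have "prime_order_ideal (Q n)" for n
  proof (rule prime_order_idealI)
    show "order_ideal (Q n)" unfolding Q_def by (rule order_ideal_adjoin[OF oi])
    show "Q n \<noteq> UNIV" using fnotin by blast
    fix x y :: 'a assume "inf x y = 0"
    then have "inf x y \<in> P" using subspace_0[OF order_ideal_subspace[OF oi]] by simp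
    then show "x \<in> Q n \<or> y \<in> Q n"
      using P subset_ideal_adjoin[OF oi] unfolding Q_def prime_order_ideal_def by blast
  qed
  moreover have "decseq Q"
    unfolding Q_def by (intro decseq_SucI ideal_adjoin_mono dec)
  ultimately obtain k where k: "\<forall>n\<ge>k. Q n = Q k"
    using pa unfolding prime_artinian_def by blast
  \<comment> \<open>The index in \<open>Q\<close> is shifted: \<open>f (Suc k)\<close> is adjoined
    in \<open>Q k\<close> but is not an element of \<open>Q (Suc k)\<close>, so the sequence drops
    at every \<open>k\<close>.\<close>
  have "f (Suc k) \<in> Q k" unfolding Q_def by (rule in_ideal_adjoin[OF oi pos])
  then show False using fnotin[of "Suc k"] k by (metis le_SucI order_refl)
qed

lemma sup_eq_add:
  fixes a b :: "'a::vector_lattice"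
  assumes "inf a b = 0"
  shows "sup a b = a + b"
  using add_eq_inf_sup[of a b] assms by simp

section \<open>Finiteness of order bounded disjoint sets\<close>

text \<open>Uniform completeness and the prime Artinian property enter the construction of the
  isomorphism through this property.\<close>

definition disjoint_finite :: "'a::vector_lattice itself \<Rightarrow> bool" where
  "disjoint_finite _ \<longleftrightarrow>
     (\<forall>(x::'a) D. (\<forall>a\<in>D. 0 < a \<and> a \<le> x) \<longrightarrow> pairwise (\<lambda>a b. inf a b = 0) D \<longrightarrow> finite D)"

text \<open>The element \<open>f k\<close> is the uniform sum of the terms
  \<open>w k n *\<^sub>R e n\<close>. It is outside the ideal \<open>I\<close> generated by all
  \<open>e n\<close>, because it dominates a positive multiple of every \<open>e N\<close>. Up to
  finitely many terms, which lie in \<open>I\<close>, each natural multiple of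
  \<open>f (Suc k)\<close> is below \<open>f k\<close>.\<close>

lemma no_bounded_disjoint_sequence:
  fixes e :: "nat \<Rightarrow> 'a::vector_lattice"
  assumes arch: "archimedean TYPE('a)" and uc: "uniformly_complete TYPE('a)"
    and pa: "prime_artinian TYPE('a)"
    and e: "\<And>n. 0 < e n" "\<And>n. e n \<le> x" "\<And>m n. m \<noteq> n \<Longrightarrow> inf (e m) (e n) = 0"
  shows False
proof -
  have e0: "0 \<le> e n" for n using e(1) by (rule less_imp_le)
  have x: "0 \<le> x" using e0 e(2) by (rule order_trans)
  \<comment> \<open>For every \<open>k\<close> the weights are at most \<open>(1/2) ^ n\<close>, so
    the series converges uniformly with regulator \<open>x\<close>; from \<open>k\<close> to
    \<open>Suc k\<close> they shrink by \<open>(1/2) ^ n\<close>, which tends to 0 as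
    \<open>n\<close> grows.\<close>
  define w where "w k n = (1/2::real) ^ (n * Suc k)" for k n :: nat
  have w0: "0 < w k n" for k n by (simp add: w_def)
  have w_Suc: "w (Suc k) n = (1/2) ^ n * w k n" for k n
    by (simp add: w_def power_add)
  have w_half: "w k n \<le> (1/2) ^ n" for k n
    unfolding w_def by (intro power_decreasing) auto
  have w_dec: "w (Suc k) n \<le> w k n" for k n
    using w0[of k n] mult_right_mono[of "(1/2) ^ n" 1 "w k n"] power_le_one[of "1/2::real" n]
    by (simp add: w_Suc)
  define S where "S k N = (\<Sum>n<N. w k n *\<^sub>R e n)" for k N
  have term0: "0 \<le> w k n *\<^sub>R e n" for k n
    using w0[of k n] e0 by (intro scaleR_nonneg_nonneg) auto
  have S_Suc: "S k (Suc N) = S k N + w k N *\<^sub>R e N" for k N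
    by (simp add: S_def)
  have S_mono: "S k N \<le> S k M" if "N \<le> M" for k N M
    unfolding S_def using that term0 by (intro sum_mono2) auto
  \<comment> \<open>The coefficient is the geometric sum of \<open>(1/2) ^ n\<close> over
    \<open>n\<close> from \<open>N\<close> to \<open>M - 1\<close>. Its exact value makes the
    induction on \<open>M\<close> work; \<open>S_tail\<close> then drops the negative term.\<close>
  have S_tail': "S k M \<le> S k N + (2 * (1/2) ^ N - 2 * (1/2) ^ M) *\<^sub>R x" if "N \<le> M" for k N M
    using that
  proof (induction M rule: dec_induct)
    case (step M)
    have "w k M *\<^sub>R e M \<le> w k M *\<^sub>R x"
      using w0[of k M] e(2) by (intro scaleR_left_mono) auto
    also have "\<dots> \<le> ((1/2) ^ M) *\<^sub>R x" using w_half x by (rule scaleR_right_mono)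
    finally have "S k (Suc M) \<le> (S k N + (2 * (1/2) ^ N - 2 * (1/2) ^ M) *\<^sub>R x) + ((1/2) ^ M) *\<^sub>R x"
      unfolding S_Suc using step.IH by (intro add_mono)
    also have "\<dots> = S k N + (2 * (1/2) ^ N - 2 * (1/2) ^ Suc M) *\<^sub>R x"
      by (simp add: add.assoc flip: scaleR_left_distrib)
    finally show ?case .
  qed simp
  have S_tail: "S k M \<le> S k N + (2 * (1/2) ^ N) *\<^sub>R x" if "N \<le> M" for k N M
  proof -
    note S_tail'[OF that, of k]
    also have "S k N + (2 * (1/2) ^ N - 2 * (1/2) ^ M) *\<^sub>R x \<le> S k N + (2 * (1/2) ^ N) *\<^sub>R x"
      by (intro add_left_mono scaleR_right_mono x) simp
    finally show ?thesis .
  qed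
  have "ru_cauchy UNIV (\<le>) (S k) x" for k
    unfolding ru_cauchy_def
  proof (intro allI impI)
    fix \<epsilon> :: real assume "0 < \<epsilon>"
    then obtain N where "(1/2) ^ N < \<epsilon> / 2" using real_arch_pow_inv[of "\<epsilon> / 2" "1/2"] by auto
    then have N: "2 * (1/2) ^ N \<le> \<epsilon>" by simp
    have "S k b - S k c \<le> \<epsilon> *\<^sub>R x" if "N \<le> b" "N \<le> c" for b c
    proof -
      have "S k b \<le> S k N + (2 * (1/2) ^ N) *\<^sub>R x" by (rule S_tail[OF that(1)])
      also have "\<dots> \<le> S k c + \<epsilon> *\<^sub>R x"
        using S_mono[OF that(2)] scaleR_right_mono[OF N x] by (rule add_mono)
      finally show ?thesis by (simp add: diff_le_eq add.commute)
    qed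
    then have "\<bar>S k b - S k c\<bar> \<le> \<epsilon> *\<^sub>R x" if "N \<le> b" "N \<le> c" for b c
      using that by (intro abs_leI) (simp_all only: minus_diff_eq)
    then show "\<exists>a\<in>UNIV. \<forall>b\<in>UNIV. \<forall>c\<in>UNIV. a \<le> b \<longrightarrow> a \<le> c \<longrightarrow> \<bar>S k b - S k c\<bar> \<le> \<epsilon> *\<^sub>R x"
      by blast
  qed
  moreover have "directed_by (UNIV :: nat set) (\<le>)"
    unfolding directed_by_def reflp_on_def transp_on_def
    using max.cobounded1 max.cobounded2 by (blast intro: order_trans)
  ultimately have "\<forall>k. \<exists>l. ru_converges UNIV (\<le>) (S k) l x"
    using uniformly_complete_net[OF uc _ x] by blast
  then obtain f where f: "\<And>k. ru_converges UNIV (\<le>) (S k) (f k) x" by metis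
  have close: "\<exists>M\<ge>N. \<bar>S k M - f k\<bar> \<le> \<epsilon> *\<^sub>R x" if "0 < \<epsilon>" for \<epsilon> k N
  proof -
    obtain a where "\<And>b. a \<le> b \<Longrightarrow> \<bar>S k b - f k\<bar> \<le> \<epsilon> *\<^sub>R x"
      using f[of k] \<open>0 < \<epsilon>\<close> unfolding ru_converges_def by blast
    then show ?thesis by (intro exI[of _ "max a N"]) simp
  qed
  \<comment> \<open>This fact and \<open>f_le\<close> identify \<open>f k\<close> as the supremum of
    its partial sums. In \<open>f_le\<close> the bound is only required from some \<open>N\<close>
    on, so that initial terms can be ignored.\<close>
  have S_le_f: "S k N \<le> f k" for k N
  proof (rule archimedean_le[OF arch x])
    fix \<epsilon> :: real assume "0 < \<epsilon>"
    then obtain M where M: "N \<le> M" "\<bar>S k M - f k\<bar> \<le> \<epsilon> *\<^sub>R x" using close by blast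
    have "S k M - f k \<le> \<epsilon> *\<^sub>R x" using abs_ge_self M(2) by (rule order_trans)
    then have "S k M \<le> f k + \<epsilon> *\<^sub>R x" by (simp add: diff_le_eq add.commute)
    with S_mono[OF M(1)] show "S k N \<le> f k + \<epsilon> *\<^sub>R x" by (rule order_trans)
  qed
  have f_le: "f k \<le> z" if z: "\<And>M. N \<le> M \<Longrightarrow> S k M \<le> z" for k N z
  proof (rule archimedean_le[OF arch x])
    fix \<epsilon> :: real assume "0 < \<epsilon>"
    then obtain M where M: "N \<le> M" "\<bar>S k M - f k\<bar> \<le> \<epsilon> *\<^sub>R x" using close by blast
    have "f k - S k M \<le> \<epsilon> *\<^sub>R x"
      using abs_ge_minus_self[of "S k M - f k"] M(2) by (simp only: minus_diff_eq)
    then have "f k \<le> S k M + \<epsilon> *\<^sub>R x" by (simp add: diff_le_eq add.commute)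
    also have "\<dots> \<le> z + \<epsilon> *\<^sub>R x" using z[OF M(1)] by (rule add_right_mono)
    finally show "f k \<le> z + \<epsilon> *\<^sub>R x" .
  qed
  have f0: "0 \<le> f k" for k using S_le_f[of k 0] by (simp add: S_def)
  have f_dec: "f (Suc k) \<le> f k" for k
  proof (rule f_le)
    fix M
    have "S (Suc k) M \<le> S k M"
      unfolding S_def using w_dec e0 by (intro sum_mono scaleR_right_mono)
    then show "S (Suc k) M \<le> f k" using S_le_f by (rule order_trans)
  qed
  \<comment> \<open>The sums \<open>E N\<close> increase, so a multiple of a single one bounds any
    element of the ideal generated by the \<open>e n\<close>. The index \<open>N\<close> is excluded
    from the sum, which keeps \<open>e N\<close> disjoint from \<open>E N\<close>.\<close>
  define E where "E N = (\<Sum>n<N. e n)" for N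
  have E0: "0 \<le> E N" for N unfolding E_def using e0 by (intro sum_nonneg)
  have E_mono: "E N \<le> E M" if "N \<le> M" for N M
    unfolding E_def using that e0 by (intro sum_mono2) auto
  define I where "I = {y. \<exists>N. \<exists>c\<ge>0. \<bar>y\<bar> \<le> c *\<^sub>R E N}"
  have II: "y \<in> I" if "0 \<le> c" "\<bar>y\<bar> \<le> c *\<^sub>R E N" for c y N
    using that unfolding I_def by blast
  have I: "order_ideal I"
  proof (rule order_idealI)
    show "0 \<in> I" using II[of 0 0 0] by simp
  next
    fix y z assume "y \<in> I" "z \<in> I"
    then obtain N c M d where *: "0 \<le> c" "\<bar>y\<bar> \<le> c *\<^sub>R E N" "0 \<le> d" "\<bar>z\<bar> \<le> d *\<^sub>R E M"
      unfolding I_def by blast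
    have "\<bar>y + z\<bar> \<le> \<bar>y\<bar> + \<bar>z\<bar>" by (rule abs_triangle_ineq)
    also have "\<dots> \<le> c *\<^sub>R E N + d *\<^sub>R E M" using *(2,4) by (rule add_mono)
    also have "\<dots> \<le> c *\<^sub>R E (max N M) + d *\<^sub>R E (max N M)"
      using * by (intro add_mono scaleR_left_mono E_mono) auto
    also have "\<dots> = (c + d) *\<^sub>R E (max N M)" by (simp add: scaleR_left_distrib)
    finally show "y + z \<in> I" using *(1,3) by (intro II) auto
  next
    fix c y assume "y \<in> I"
    then obtain N d where *: "0 \<le> d" "\<bar>y\<bar> \<le> d *\<^sub>R E N" unfolding I_def by blast
    have "\<bar>c *\<^sub>R y\<bar> \<le> \<bar>c\<bar> *\<^sub>R \<bar>y\<bar>" by (rule abs_scaleR_le)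
    also have "\<dots> \<le> \<bar>c\<bar> *\<^sub>R d *\<^sub>R E N" using *(2) by (intro scaleR_left_mono) auto
    finally show "c *\<^sub>R y \<in> I" using *(1) by (intro II[of "\<bar>c\<bar> * d"]) auto
  next
    fix y z :: 'a assume yz: "\<bar>y\<bar> \<le> \<bar>z\<bar>" and "z \<in> I"
    then obtain N d where *: "0 \<le> d" "\<bar>z\<bar> \<le> d *\<^sub>R E N" unfolding I_def by blast
    from order_trans[OF yz *(2)] show "y \<in> I" using *(1) by (intro II)
  qed
  have S0: "0 \<le> S k N" for k N unfolding S_def using term0 by (intro sum_nonneg)
  have S_I: "S k N \<in> I" for k N
  proof (rule II)
    have "S k N \<le> E N" unfolding S_def E_def
    proof (rule sum_mono)
      fix n
      have "w k n \<le> 1" using w_half power_le_one by (rule order_trans) auto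
      then show "w k n *\<^sub>R e n \<le> e n" using scaleR_right_mono[OF _ e0] by fastforce
    qed
    then show "\<bar>S k N\<bar> \<le> 1 *\<^sub>R E N" using S0 by simp
  qed simp
  \<comment> \<open>If \<open>f k\<close> were bounded by a multiple of \<open>E N\<close>, so would
    be its term at \<open>N\<close>; but that term is disjoint from \<open>E N\<close> and not
    zero.\<close>
  have disj: "I \<inter> range f = {}"
  proof (rule ccontr)
    assume "\<not> ?thesis"
    then obtain k N c where *: "0 \<le> c" "\<bar>f k\<bar> \<le> c *\<^sub>R E N" unfolding I_def by blast
    let ?u = "w k N *\<^sub>R e N"
    have "?u \<le> S k (Suc N)" unfolding S_Suc using S0[of k N] by simp
    also have "\<dots> \<le> f k" by (rule S_le_f)
    also have "\<dots> \<le> c *\<^sub>R E N" using *(2) f0 by simp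
    finally have "?u \<le> inf ?u (c *\<^sub>R E N)" by simp
    also have "\<dots> = 0"
    proof (rule inf_scaleR_eq_zero[OF e0 E0 _ less_imp_le[OF w0] *(1)])
      show "inf (e N) (E N) = 0" unfolding E_def using e0 e(3) by (intro inf_sum_eq_zero) auto
    qed
    finally have "?u = 0" using term0 by (intro antisym)
    then show False using w0[of k N] e(1)[of N] by simp
  qed
  have "decseq f" using f_dec by (rule decseq_SucI)
  then have "f (max i j) \<le> f i" "f (max i j) \<le> f j" for i j by (simp_all add: decseqD)
  then have down: "\<exists>u\<in>range f. u \<le> s \<and> u \<le> t" if "s \<in> range f" "t \<in> range f" for s t
    using that by blast
  obtain P where P: "prime_order_ideal P" "I \<subseteq> P" "P \<inter> range f = {}"
  proof (rule prime_ideal_separation[OF I disj _ _ down])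
    show "0 \<le> s" if "s \<in> range f" for s using that f0 by blast
  qed auto
  \<comment> \<open>Once \<open>m * (1/2) ^ N \<le> 1\<close>, every term from index
    \<open>N\<close> on satisfies the inequality without correction; \<open>p\<close> collects the
    first \<open>N\<close> terms of \<open>m\<close> times the series for
    \<open>f (Suc k)\<close>.\<close>
  have "\<exists>p\<in>P. real m *\<^sub>R f (Suc k) \<le> f k + p" for m k
  proof (cases "m = 0")
    case True
    then show ?thesis using S_I[of 0 0] P(2) f0[of k] by (intro bexI[of _ 0]) (auto simp: S_def)
  next
    case False
    obtain N where "(1/2) ^ N < inverse (real m)"
      using real_arch_pow_inv[of "inverse (real m)" "1/2"] False by auto
    then have N: "real m * (1/2) ^ N \<le> 1" using False by (simp add: field_simps)
    let ?p = "real m *\<^sub>R S (Suc k) N"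
    have S_le: "real m *\<^sub>R S (Suc k) M \<le> S k M + ?p" if "N \<le> M" for M
      using that
    proof (induction M rule: dec_induct)
      case base
      then show ?case using S0 by simp
    next
      case (step M)
      have "real m * (1/2) ^ M \<le> real m * (1/2) ^ N"
        using step.hyps by (intro mult_left_mono power_decreasing) auto
      then have "real m * (1/2) ^ M \<le> 1" using N by (rule order_trans)
      then have "real m * w (Suc k) M \<le> w k M"
        using w0[of k M] mult_right_mono[of "real m * (1/2) ^ M" 1 "w k M"] by (simp add: w_Suc)
      from add_mono[OF step.IH scaleR_right_mono[OF this e0[of M]]]
      show ?case unfolding S_Suc by (simp add: algebra_simps)
    qed
    \<comment> \<open>Since \<open>f_le\<close> bounds \<open>f (Suc k)\<close> and not its
      multiples, \<open>m\<close> is moved to the right-hand side first and back afterwards.\<close>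
    have "f (Suc k) \<le> inverse (real m) *\<^sub>R (f k + ?p)"
    proof (rule f_le)
      fix M assume "N \<le> M"
      have "real m *\<^sub>R S (Suc k) M \<le> f k + ?p"
        using S_le[OF \<open>N \<le> M\<close>] add_right_mono[OF S_le_f] by (rule order_trans)
      then have "inverse (real m) *\<^sub>R real m *\<^sub>R S (Suc k) M \<le> inverse (real m) *\<^sub>R (f k + ?p)"
        by (intro scaleR_left_mono) auto
      then show "S (Suc k) M \<le> inverse (real m) *\<^sub>R (f k + ?p)" using False by simp
    qed
    then have "real m *\<^sub>R f (Suc k) \<le> real m *\<^sub>R inverse (real m) *\<^sub>R (f k + ?p)"
      by (intro scaleR_left_mono) auto
    then have "real m *\<^sub>R f (Suc k) \<le> f k + ?p" using False by simp
    moreover have "?p \<in> P" using S_I P(2) subspace_scale[OF order_ideal_subspace[OF I]] by blast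
    ultimately show ?thesis by blast
  qed
  then have "\<not> prime_artinian TYPE('a)"
    using P(3) by (intro not_prime_artinian_if_infinitesimals[of P f] P(1) f0 f_dec) auto
  then show False using pa by simp
qed

lemma disjoint_finiteD:
  fixes D :: "'a::vector_lattice set"
  assumes "disjoint_finite TYPE('a)" "pairwise (\<lambda>a b. inf a b = 0) D"
    "\<And>a. a \<in> D \<Longrightarrow> 0 < a" "\<And>a. a \<in> D \<Longrightarrow> a \<le> x"
  shows "finite D"
  using assms unfolding disjoint_finite_def by blast

lemma disjoint_finite_if_prime_artinian:
  assumes "archimedean TYPE('a::vector_lattice)" "uniformly_complete TYPE('a)"
    "prime_artinian TYPE('a)"
  shows "disjoint_finite TYPE('a)"
  unfolding disjoint_finite_def
proof (intro allI impI, rule ccontr)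
  fix x :: 'a and D
  assume D: "\<forall>a\<in>D. 0 < a \<and> a \<le> x" "pairwise (\<lambda>a b. inf a b = 0) D" and "infinite D"
  then obtain e :: "nat \<Rightarrow> 'a" where e: "inj e" "range e \<subseteq> D"
    using infinite_countable_subset by blast
  have "inf (e m) (e n) = 0" if "m \<noteq> n" for m n
    using D(2) e that unfolding pairwise_def inj_def by blast
  then show False
    using no_bounded_disjoint_sequence[OF assms, of e x] D(1) e(2) by blast
qed

section \<open>Atoms: existence and maximal disjoint families\<close>

text \<open>The Archimedean property is used twice: it bounds the set of admissible scalars, and it
  shows that the supremum of this set is again admissible.\<close>

lemma exists_greatest_multiple_le:
  fixes a y :: "'a::vector_lattice"
  assumes arch: "archimedean TYPE('a)" and a: "0 < a" and y: "0 \<le> y"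
  obtains c where "0 \<le> c" "c *\<^sub>R a \<le> y" "\<And>t. t *\<^sub>R a \<le> y \<Longrightarrow> t \<le> c"
proof -
  have a0: "0 \<le> a" using a by (rule less_imp_le)
  define R where "R = {t. t *\<^sub>R a \<le> y}"
  obtain n :: nat where n: "\<not> real n *\<^sub>R a \<le> y"
    using arch a0 a y unfolding archimedean_def by blast
  have "t \<le> real n" if "t \<in> R" for t
  proof (rule ccontr)
    assume "\<not> ?thesis"
    then have "real n *\<^sub>R a \<le> t *\<^sub>R a" using a0 by (intro scaleR_right_mono) auto
    also have "\<dots> \<le> y" using that by (simp add: R_def)
    finally show False using n by simp
  qed
  then have bdd: "bdd_above R" by (rule bdd_aboveI)
  have zero: "0 \<in> R" using y by (simp add: R_def)
  have "Sup R *\<^sub>R a \<le> y"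
  proof (rule archimedean_le[OF arch a0])
    fix \<epsilon> :: real assume "0 < \<epsilon>"
    then have "Sup R - \<epsilon> < Sup R" by simp
    then obtain t where t: "t \<in> R" "Sup R - \<epsilon> < t"
      using less_cSup_iff[OF _ bdd] zero by blast
    have "Sup R *\<^sub>R a \<le> (t + \<epsilon>) *\<^sub>R a" using t(2) a0 by (intro scaleR_right_mono) auto
    also have "\<dots> \<le> y + \<epsilon> *\<^sub>R a" using t(1) by (simp add: R_def scaleR_left_distrib)
    finally show "Sup R *\<^sub>R a \<le> y + \<epsilon> *\<^sub>R a" .
  qed
  moreover have "0 \<le> Sup R" using cSup_upper[OF zero bdd] .
  moreover have "t \<le> Sup R" if "t *\<^sub>R a \<le> y" for t
    using cSup_upper[OF _ bdd] that by (simp add: R_def)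
  ultimately show thesis using that by blast
qed

text \<open>Equivalently, \<open>a\<close> is positive and its principal ideal is one-dimensional.
  Minimality among positive elements would be void, since \<open>a\<close> can always be
  halved.\<close>

definition lattice_atom :: "'a::vector_lattice \<Rightarrow> bool" where
  "lattice_atom a \<longleftrightarrow> 0 < a \<and> (\<forall>y. 0 \<le> y \<longrightarrow> y \<le> a \<longrightarrow> (\<exists>r. y = r *\<^sub>R a))"

text \<open>Adding the negative part \<open>?v\<close> to \<open>inf z 0 = - ?v\<close> gives 0,
  while the same shift turns \<open>z\<close> into its positive part and 0 into
  \<open>?v\<close>.\<close>

lemma inf_pos_part_neg_part:
  fixes z :: "'a::vector_lattice"
  shows "inf (sup z 0) (sup (- z) 0) = 0"
proof -
  let ?v = "sup (- z) 0"
  have "- inf z 0 = ?v" by simp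
  moreover have "z + ?v = sup z 0" using add_sup_distrib_left[of z "- z" 0] by (simp add: sup_commute)
  moreover have "inf (z + ?v) (0 + ?v) = inf z 0 + ?v" by (rule add_inf_distrib_right[symmetric])
  ultimately show ?thesis by (metis add_0 add.right_inverse)
qed

text \<open>Let \<open>c\<close> be the largest scalar with \<open>c *\<^sub>R a \<le> y\<close>.
  For \<open>s > c\<close> the positive and negative parts of \<open>y - s *\<^sub>R a\<close> are
  disjoint and the negative part is not zero, so the positive part is:
  \<open>y \<le> s *\<^sub>R a\<close>. Letting \<open>s\<close> decrease to \<open>c\<close> gives
  equality.\<close>

lemma lattice_atomI:
  fixes a :: "'a::vector_lattice"
  assumes arch: "archimedean TYPE('a)" and a: "0 < a"
    and indec: "\<And>u v. 0 \<le> u \<Longrightarrow> u \<le> a \<Longrightarrow> 0 \<le> v \<Longrightarrow> v \<le> a \<Longrightarrow> inf u v = 0 \<Longrightarrow> u = 0 \<or> v = 0"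
  shows "lattice_atom a"
  unfolding lattice_atom_def
proof (intro conjI allI impI)
  fix y assume y: "0 \<le> y" "y \<le> a"
  have a0: "0 \<le> a" using a by (rule less_imp_le)
  obtain c where c: "0 \<le> c" "c *\<^sub>R a \<le> y" "\<And>t. t *\<^sub>R a \<le> y \<Longrightarrow> t \<le> c"
    using exists_greatest_multiple_le[OF arch a y(1)] by blast
  have "y \<le> c *\<^sub>R a"
  proof (rule archimedean_le[OF arch a0])
    fix \<epsilon> :: real assume "0 < \<epsilon>"
    define s where "s = c + \<epsilon>"
    have s: "0 < s" "\<not> s *\<^sub>R a \<le> y" using c(1) c(3)[of s] \<open>0 < \<epsilon>\<close> by (auto simp: s_def)
    have sa: "0 \<le> s *\<^sub>R a" using s(1) a0 by (intro scaleR_nonneg_nonneg) auto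
    let ?u = "sup (y - s *\<^sub>R a) 0" and ?v = "sup (s *\<^sub>R a - y) 0"
    have uv: "inf ?u ?v = 0" using inf_pos_part_neg_part[of "y - s *\<^sub>R a"] by simp
    have u: "?u \<le> a"
    proof (rule sup_least)
      have "y - s *\<^sub>R a \<le> y" using sa by simp
      then show "y - s *\<^sub>R a \<le> a" using y(2) by (rule order_trans)
    qed (rule a0)
    \<comment> \<open>As \<open>s\<close> may exceed 1, \<open>?v\<close> need not lie below
      \<open>a\<close>; dividing by \<open>s\<close> brings it there and preserves
      disjointness.\<close>
    have "?v \<le> s *\<^sub>R a" using y(1) sa by simp
    then have "inverse s *\<^sub>R ?v \<le> inverse s *\<^sub>R s *\<^sub>R a" using s(1) by (intro scaleR_left_mono) auto
    then have v: "inverse s *\<^sub>R ?v \<le> a" using s(1) by simp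
    have "inf (1 *\<^sub>R ?u) (inverse s *\<^sub>R ?v) = 0"
      using uv s(1) by (intro inf_scaleR_eq_zero) auto
    then have "?u = 0 \<or> inverse s *\<^sub>R ?v = 0"
      using u v s(1) by (intro indec) (auto intro: scaleR_nonneg_nonneg)
    moreover have "inverse s *\<^sub>R ?v \<noteq> 0"
    proof
      assume "inverse s *\<^sub>R ?v = 0"
      then have "?v = 0" using s(1) by simp
      moreover have "s *\<^sub>R a - y \<le> ?v" by simp
      ultimately show False using s(2) by simp
    qed
    ultimately have "?u = 0" by blast
    moreover have "y - s *\<^sub>R a \<le> ?u" by simp
    ultimately have "y \<le> s *\<^sub>R a" by simp
    then show "y \<le> c *\<^sub>R a + \<epsilon> *\<^sub>R a" by (simp add: s_def scaleR_left_distrib)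
  qed
  then show "\<exists>r. y = r *\<^sub>R a" using c(2) by (blast intro: antisym)
qed (rule a)

text \<open>If no atom lies below \<open>x\<close>, one can keep splitting: each step yields disjoint nonzero
  elements below \<open>x\<close>, of which one is kept and the other one is split further.\<close>

lemma exists_lattice_atom_le:
  fixes x :: "'a::vector_lattice"
  assumes arch: "archimedean TYPE('a)" and df: "disjoint_finite TYPE('a)" and x: "0 < x"
  shows "\<exists>a\<le>x. lattice_atom a"
proof (rule ccontr)
  assume no: "\<not> ?thesis"
  define Q where "Q v \<longleftrightarrow> 0 < v \<and> v \<le> x" for v
  \<comment> \<open>The first component is the piece to keep, the second the piece to split
    next.\<close>
  define P where "P p \<longleftrightarrow> Q (fst p) \<and> Q (snd p) \<and> inf (fst p) (snd p) = 0" for p :: "'a \<times> 'a"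
  have split: "\<exists>p. P p \<and> fst p \<le> v \<and> snd p \<le> v" if "Q v" for v
  proof -
    have "\<not> lattice_atom v" using no that by (auto simp: Q_def)
    moreover have "0 < v" using that by (simp add: Q_def)
    ultimately obtain u u' where u: "0 \<le> u" "u \<le> v" "0 \<le> u'" "u' \<le> v" "inf u u' = 0" "u \<noteq> 0" "u' \<noteq> 0"
      using lattice_atomI[OF arch, of v] by metis
    have "v \<le> x" using that by (simp add: Q_def)
    then have "P (u, u')"
      using u order_trans[OF u(2)] order_trans[OF u(4)] by (simp add: P_def Q_def order_less_le)
    then show ?thesis using u by (intro exI[of _ "(u, u')"]) simp
  qed
  have "\<exists>s. \<forall>n. P (s n) \<and> (fst (s (Suc n)) \<le> snd (s n) \<and> snd (s (Suc n)) \<le> snd (s n))"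
  proof (rule dependent_nat_choice)
    show "\<exists>p. P p" using split[of x] x by (auto simp: Q_def)
    show "\<exists>q. P q \<and> fst q \<le> snd p \<and> snd q \<le> snd p" if "P p" for p and n :: nat
      using that by (intro split) (simp add: P_def)
  qed
  then obtain s where s: "\<And>n. P (s n)" "\<And>n. fst (s (Suc n)) \<le> snd (s n)"
      "\<And>n. snd (s (Suc n)) \<le> snd (s n)" by blast
  have pos: "0 < fst (s n)" "fst (s n) \<le> x" "0 < snd (s n)" "inf (fst (s n)) (snd (s n)) = 0" for n
    using s(1)[of n] by (auto simp: P_def Q_def)
  have dec: "snd (s n) \<le> snd (s m)" if "m \<le> n" for m n
    using decseq_SucI[of "snd \<circ> s"] s(3) that by (simp add: decseq_def)
  \<comment> \<open>A piece kept later lies inside the second component at stage \<open>m\<close>,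
    which is disjoint from the piece kept at that stage.\<close>
  have disj: "inf (fst (s m)) (fst (s n)) = 0" if "m < n" for m n
  proof -
    obtain k where k: "n = Suc k" "m \<le> k" using \<open>m < n\<close> by (cases n) auto
    have "fst (s n) \<le> snd (s m)" using s(2)[of k] dec[OF k(2)] unfolding k(1) by (rule order_trans)
    then show ?thesis using inf_eq_zero_mono[OF pos(4)[of m]] pos(1) by (simp add: less_imp_le)
  qed
  then have disj': "inf (fst (s m)) (fst (s n)) = 0" if "m \<noteq> n" for m n
    using that by (metis inf_commute linorder_neqE_nat)
  have "inj (fst \<circ> s)"
  proof (rule injI)
    fix m n assume "(fst \<circ> s) m = (fst \<circ> s) n"
    then show "m = n" using disj'[of m n] pos(1)[of n] by (cases "m = n") auto
  qed
  then have "infinite (range (fst \<circ> s))" using finite_imageD by blast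
  moreover have "finite (range (fst \<circ> s))"
  proof -
    have "pairwise (\<lambda>a b. inf a b = 0) (range (fst \<circ> s))"
      unfolding pairwise_image by (rule pairwiseI) (metis comp_apply disj')
    then show ?thesis using pos by (intro disjoint_finiteD[OF df, of _ x]) auto
  qed
  ultimately show False by blast
qed

text \<open>The infimum lies below both atoms, so it is a multiple of each; if it is not zero, one
  atom can be solved for in terms of the other.\<close>

lemma lattice_atoms_disjoint_or_proportional:
  assumes a: "lattice_atom a" and b: "lattice_atom b"
  shows "inf a b = 0 \<or> (\<exists>r. b = r *\<^sub>R a)"
proof (cases "inf a b = 0")
  case False
  have "0 \<le> a" "0 \<le> b" using a b by (auto simp: lattice_atom_def)
  then have "0 \<le> inf a b" by simp
  then obtain r s where rs: "inf a b = r *\<^sub>R a" "inf a b = s *\<^sub>R b"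
    using a b unfolding lattice_atom_def by (meson inf.cobounded1 inf.cobounded2)
  then have "s \<noteq> 0" using False by auto
  then have "b = inverse s *\<^sub>R s *\<^sub>R b" by simp
  also have "\<dots> = (inverse s * r) *\<^sub>R a" using rs by simp
  finally show ?thesis by blast
qed simp

text \<open>Zorn's lemma gives a maximal disjoint set of atoms. An atom proportional to none of its
  members is disjoint from all of them and could be added.\<close>

lemma exists_disjoint_lattice_atoms:
  obtains \<Omega> :: "'a::vector_lattice set"
  where "\<And>a. a \<in> \<Omega> \<Longrightarrow> lattice_atom a" "pairwise (\<lambda>a b. inf a b = 0) \<Omega>"
    "\<And>b. lattice_atom b \<Longrightarrow> \<exists>a\<in>\<Omega>. \<exists>r. b = r *\<^sub>R a"
proof -
  let ?A = "{D :: 'a set. (\<forall>a\<in>D. lattice_atom a) \<and> pairwise (\<lambda>a b. inf a b = 0) D}"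
  have "\<exists>D\<in>?A. \<forall>X\<in>?A. D \<subseteq> X \<longrightarrow> X = D"
  proof (rule subset_Zorn')
    fix C assume "subset.chain ?A C"
    then have atoms: "\<forall>a\<in>\<Union>C. lattice_atom a"
      and pw: "\<And>X. X \<in> C \<Longrightarrow> pairwise (\<lambda>a b. inf a b = 0) X"
      and total: "\<And>X Y. X \<in> C \<Longrightarrow> Y \<in> C \<Longrightarrow> X \<subseteq> Y \<or> Y \<subseteq> X"
      unfolding subset_chain_def by auto
    have "pairwise (\<lambda>a b. inf a b = 0) (\<Union>C)"
    proof (rule pairwiseI)
      fix a b assume "a \<in> \<Union>C" "b \<in> \<Union>C" "a \<noteq> b"
      moreover from this obtain X where "X \<in> C" "a \<in> X" "b \<in> X" using total by blast
      ultimately show "inf a b = 0" using pairwiseD[OF pw] by simp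
    qed
    with atoms show "\<Union>C \<in> ?A" by simp
  qed
  then obtain \<Omega> where "\<Omega> \<in> ?A" and max: "\<forall>X\<in>?A. \<Omega> \<subseteq> X \<longrightarrow> X = \<Omega>" ..
  then have \<Omega>: "\<And>a. a \<in> \<Omega> \<Longrightarrow> lattice_atom a" "pairwise (\<lambda>a b. inf a b = 0) \<Omega>" by auto
  moreover have "\<exists>a\<in>\<Omega>. \<exists>r. b = r *\<^sub>R a" if b: "lattice_atom b" for b
  proof (rule ccontr)
    assume "\<not> ?thesis"
    then have np: "\<nexists>r. b = r *\<^sub>R a" if "a \<in> \<Omega>" for a using that by blast
    then have "inf a b = 0" if "a \<in> \<Omega>" for a
      using lattice_atoms_disjoint_or_proportional[OF \<Omega>(1) b] that by blast
    then have "pairwise (\<lambda>a b. inf a b = 0) (insert b \<Omega>)"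
      using \<Omega>(2) by (auto simp: pairwise_insert inf_commute)
    then have "insert b \<Omega> = \<Omega>" using max \<Omega>(1) b by blast
    then have "b \<in> \<Omega>" by blast
    moreover have "b = 1 *\<^sub>R b" by simp
    ultimately show False using np by blast
  qed
  ultimately show thesis using that by blast
qed

section \<open>Expansion in atoms and the coordinate isomorphism\<close>

text \<open>A finite sum of pairwise disjoint positive elements is their supremum.\<close>

lemma sum_disjoint_le:
  fixes b :: "'i \<Rightarrow> 'a::vector_lattice"
  assumes "finite F" "0 \<le> x" "\<And>i. i \<in> F \<Longrightarrow> 0 \<le> b i" "\<And>i. i \<in> F \<Longrightarrow> b i \<le> x"
    "\<And>i j. i \<in> F \<Longrightarrow> j \<in> F \<Longrightarrow> i \<noteq> j \<Longrightarrow> inf (b i) (b j) = 0"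
  shows "sum b F \<le> x"
  using assms(1,3-)
proof (induction F)
  case (insert i F)
  have "inf (b i) (sum b F) = 0"
    using insert.prems insert.hyps by (intro inf_sum_eq_zero) auto
  then have "sum b (insert i F) = sup (b i) (sum b F)"
    using insert.hyps by (simp add: sup_eq_add)
  also have "\<dots> \<le> x" using insert.IH insert.prems by (intro sup_least) auto
  finally show ?case .
qed (use assms(2) in simp)

text \<open>Let \<open>c a\<close> be the largest scalar with
  \<open>c a *\<^sub>R a \<le> x\<close>. The nonzero terms are disjoint and bounded by
  \<open>x\<close>, so there are finitely many and their sum is below \<open>x\<close>. An atom
  below a positive remainder would be a positive multiple of some \<open>a\<close> in \<Omega> and
  contradict the choice of \<open>c a\<close>.\<close>

lemma nonneg_eq_sum_atoms:
  fixes \<Omega> :: "'a::vector_lattice set"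
  assumes arch: "archimedean TYPE('a)" and df: "disjoint_finite TYPE('a)"
    and atom: "\<And>a. a \<in> \<Omega> \<Longrightarrow> lattice_atom a" and disj: "pairwise (\<lambda>a b. inf a b = 0) \<Omega>"
    and all: "\<And>b. lattice_atom b \<Longrightarrow> \<exists>a\<in>\<Omega>. \<exists>r. b = r *\<^sub>R a"
    and x: "0 \<le> x"
  obtains F c where "finite F" "F \<subseteq> \<Omega>" "\<And>a. 0 \<le> c a" "x = (\<Sum>a\<in>F. c a *\<^sub>R a)"
proof -
  have pos: "0 < a" "0 \<le> a" if "a \<in> \<Omega>" for a
    using atom[OF that] by (auto simp: lattice_atom_def)
  have "\<exists>c\<ge>0. a \<in> \<Omega> \<longrightarrow> c *\<^sub>R a \<le> x \<and> (\<forall>t. t *\<^sub>R a \<le> x \<longrightarrow> t \<le> c)" for a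
  proof (cases "a \<in> \<Omega>")
    case True
    obtain c where "0 \<le> c" "c *\<^sub>R a \<le> x" "\<And>t. t *\<^sub>R a \<le> x \<Longrightarrow> t \<le> c"
      using exists_greatest_multiple_le[OF arch pos(1)[OF True] x] by blast
    then show ?thesis by blast
  qed auto
  then obtain c :: "'a \<Rightarrow> real" where c: "\<And>a. 0 \<le> c a" "\<And>a. a \<in> \<Omega> \<Longrightarrow> c a *\<^sub>R a \<le> x"
      "\<And>a t. a \<in> \<Omega> \<Longrightarrow> t *\<^sub>R a \<le> x \<Longrightarrow> t \<le> c a" by metis
  define F where "F = {a\<in>\<Omega>. c a > 0}"
  have term0: "0 \<le> c a *\<^sub>R a" if "a \<in> \<Omega>" for a using c(1) pos that by (intro scaleR_nonneg_nonneg)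
  have disj': "inf (c a *\<^sub>R a) (c b *\<^sub>R b) = 0" if "a \<in> \<Omega>" "b \<in> \<Omega>" "a \<noteq> b" for a b
    using that disj pos c(1) by (intro inf_scaleR_eq_zero) (auto simp: pairwise_def)
  have nz: "c a *\<^sub>R a \<noteq> 0" if "a \<in> F" for a using that pos(1)[of a] by (auto simp: F_def)
  \<comment> \<open>Finiteness is known for the set of terms; injectivity transfers it to the index
    set \<open>F\<close>.\<close>
  have inj: "inj_on (\<lambda>a. c a *\<^sub>R a) F"
  proof (rule inj_onI, rule ccontr)
    fix a b assume ab: "a \<in> F" "b \<in> F" "c a *\<^sub>R a = c b *\<^sub>R b" "a \<noteq> b"
    then have "inf (c a *\<^sub>R a) (c b *\<^sub>R b) = 0" by (intro disj') (auto simp: F_def)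
    then show False using ab nz[of b] by simp
  qed
  have "finite ((\<lambda>a. c a *\<^sub>R a) ` F)"
  proof -
    have "0 < c a *\<^sub>R a \<and> c a *\<^sub>R a \<le> x" if "a \<in> F" for a
      using that nz[OF that] term0[of a] c(2)[of a] by (auto simp: F_def order_less_le)
    then show ?thesis
    proof (intro disjoint_finiteD[OF df, of _ x])
      show "pairwise (\<lambda>a b. inf a b = 0) ((\<lambda>a. c a *\<^sub>R a) ` F)"
        unfolding pairwise_image by (intro pairwiseI impI disj') (auto simp: F_def)
    qed auto
  qed
  then have fin: "finite F" using inj by (rule finite_imageD)
  let ?s = "\<Sum>a\<in>F. c a *\<^sub>R a"
  have "?s \<le> x"
    using fin x term0 c(2) disj' by (intro sum_disjoint_le) (auto simp: F_def)
  moreover have "x \<le> ?s"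
  proof (rule ccontr)
    assume "\<not> ?thesis"
    then have "0 < x - ?s" using \<open>?s \<le> x\<close> by (simp add: order_less_le)
    then obtain b where b: "b \<le> x - ?s" "lattice_atom b"
      using exists_lattice_atom_le[OF arch df] by blast
    then obtain a r where ar: "a \<in> \<Omega>" "b = r *\<^sub>R a" using all by blast
    have "0 < r *\<^sub>R a" using b(2) ar(2) by (simp add: lattice_atom_def)
    have r: "0 < r"
    proof (rule ccontr)
      assume "\<not> 0 < r"
      then have "r *\<^sub>R a \<le> 0 *\<^sub>R a" using pos(2)[OF ar(1)] by (intro scaleR_right_mono) auto
      then show False using \<open>0 < r *\<^sub>R a\<close> by simp
    qed
    \<comment> \<open>The atom found below the remainder may be one outside \<open>F\<close>; then
      its coefficient is 0.\<close>
    have "c a *\<^sub>R a \<le> ?s"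
    proof (cases "a \<in> F")
      case True
      have "0 \<le> (\<Sum>b\<in>F - {a}. c b *\<^sub>R b)" using term0 by (intro sum_nonneg) (auto simp: F_def)
      then show ?thesis using sum.remove[OF fin True, of "\<lambda>b. c b *\<^sub>R b"] by simp
    next
      case False
      then have "c a = 0" using ar(1) c(1)[of a] by (auto simp: F_def)
      then show ?thesis using term0 by (auto simp: F_def intro: sum_nonneg)
    qed
    then have "c a *\<^sub>R a + r *\<^sub>R a \<le> ?s + (x - ?s)"
      using b(1) unfolding ar(2) by (rule add_mono)
    then have "(c a + r) *\<^sub>R a \<le> x" by (simp add: scaleR_left_distrib)
    then show False using c(3)[OF ar(1)] r by fastforce
  qed
  ultimately have "x = ?s" by (intro antisym)
  then show thesis using that[of F c] fin c(1) by (auto simp: F_def)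
qed

text \<open>In a vanishing combination each term is dominated in modulus by the sum of the moduli of
  the others, from which it is disjoint; hence it is zero.\<close>

lemma independent_if_disjoint:
  fixes \<Omega> :: "'a::vector_lattice set"
  assumes pos: "\<And>a. a \<in> \<Omega> \<Longrightarrow> 0 < a" and disj: "pairwise (\<lambda>a b. inf a b = 0) \<Omega>"
  shows "independent \<Omega>"
  unfolding dependent_explicit
proof (rule notI, elim exE conjE bexE)
  fix F u v
  assume F: "finite F" "F \<subseteq> \<Omega>" "(\<Sum>a\<in>F. u a *\<^sub>R a) = 0" and v: "v \<in> F" "u v \<noteq> 0"
  have pos': "0 \<le> a" if "a \<in> F" for a using pos F(2) that by (auto intro: less_imp_le)
  let ?s = "\<Sum>a\<in>F - {v}. \<bar>u a\<bar> *\<^sub>R a"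
  have "u v *\<^sub>R v = - (\<Sum>a\<in>F - {v}. u a *\<^sub>R a)"
    using F(1,3) v(1) by (simp add: sum.remove eq_neg_iff_add_eq_0)
  then have "\<bar>u v *\<^sub>R v\<bar> = \<bar>\<Sum>a\<in>F - {v}. u a *\<^sub>R a\<bar>" by (simp only: abs_minus_cancel)
  also have "\<dots> \<le> ?s"
  proof (rule abs_leI)
    show "(\<Sum>a\<in>F - {v}. u a *\<^sub>R a) \<le> ?s"
      using pos' by (intro sum_mono scaleR_right_mono) auto
    show "- (\<Sum>a\<in>F - {v}. u a *\<^sub>R a) \<le> ?s"
      unfolding sum_negf[symmetric] scaleR_minus_left[symmetric]
      using pos' by (intro sum_mono scaleR_right_mono) auto
  qed
  finally have le: "\<bar>u v *\<^sub>R v\<bar> \<le> ?s" .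
  have "inf (\<bar>u v\<bar> *\<^sub>R v) ?s = 0"
  proof (rule inf_sum_eq_zero)
    show "0 \<le> \<bar>u v\<bar> *\<^sub>R v" using pos' v by (intro scaleR_nonneg_nonneg) auto
  next
    fix a assume a: "a \<in> F - {v}"
    then show "0 \<le> \<bar>u a\<bar> *\<^sub>R a" using pos' by (intro scaleR_nonneg_nonneg) auto
    have "inf v a = 0" using pairwiseD[OF disj, of v a] F(2) v(1) a by auto
    then show "inf (\<bar>u v\<bar> *\<^sub>R v) (\<bar>u a\<bar> *\<^sub>R a) = 0"
      using a pos' v by (intro inf_scaleR_eq_zero) auto
  qed
  moreover have "\<bar>u v\<bar> *\<^sub>R v \<le> ?s"
  proof (rule order_trans[OF _ le])
    show "\<bar>u v\<bar> *\<^sub>R v \<le> \<bar>u v *\<^sub>R v\<bar>"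
      using abs_ge_self[of "u v *\<^sub>R v"] abs_ge_minus_self[of "u v *\<^sub>R v"] by (simp add: abs_if)
  qed
  ultimately have "\<bar>u v\<bar> *\<^sub>R v = 0" by (simp add: inf_absorb1)
  then show False using v(2) pos[of v] F(2) v(1) by auto
qed

text \<open>Suprema are determined by the order: the pointwise maximum is again in
  \<open>c00 \<Omega>\<close>, hence the image of some \<open>z\<close>, and \<open>z\<close> is the
  least upper bound. Infima follow from \<open>inf x y = x + y - sup x y\<close>.\<close>

lemma lattice_iso_c00I:
  fixes T :: "'a::vector_lattice \<Rightarrow> 'b \<Rightarrow> real"
  assumes bij: "bij_betw T UNIV (c00 \<Omega>)"
    and add: "\<And>x y. T (x + y) = (\<lambda>w. T x w + T y w)"
    and scale: "\<And>r x. T (r *\<^sub>R x) = (\<lambda>w. r * T x w)"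
    and nonneg: "\<And>x. 0 \<le> x \<longleftrightarrow> (\<forall>w. 0 \<le> T x w)"
  shows "lattice_iso_c00 \<Omega> T"
proof -
  have neg: "T (- x) w = - T x w" for x w using scale[of "-1" x] by simp
  have diff: "T (x - y) w = T x w - T y w" for x y w
    using add[of x "- y"] neg[of y w] by simp
  have le: "x \<le> y \<longleftrightarrow> (\<forall>w. T x w \<le> T y w)" for x y
    using nonneg[of "y - x"] by (simp add: diff)
  have c00: "T x \<in> c00 \<Omega>" for x using bij by (auto simp: bij_betw_def)
  have sup: "T (sup x y) = (\<lambda>w. max (T x w) (T y w))" for x y
  proof -
    have "{w. max (T x w) (T y w) \<noteq> 0} \<subseteq> {w. T x w \<noteq> 0} \<union> {w. T y w \<noteq> 0}"
      by (auto simp: max_def)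
    then have "finite {w. max (T x w) (T y w) \<noteq> 0}"
      using c00[of x] c00[of y] by (auto simp: c00_def intro: finite_subset)
    then have "(\<lambda>w. max (T x w) (T y w)) \<in> c00 \<Omega>"
      using c00[of x] c00[of y] by (simp add: c00_def)
    then obtain z where z: "T z = (\<lambda>w. max (T x w) (T y w))"
      using bij unfolding bij_betw_def by (metis imageE)
    have "sup x y = z"
    proof (rule antisym)
      have "x \<le> z" "y \<le> z" by (simp_all add: le z)
      then show "sup x y \<le> z" by (rule sup_least)
      have "T x w \<le> T (sup x y) w" "T y w \<le> T (sup x y) w" for w
        using le[of x "sup x y"] le[of y "sup x y"] by simp_all
      then show "z \<le> sup x y" by (simp add: le z)
    qed
    then show ?thesis using z by simp
  qed
  have inf: "T (inf x y) = (\<lambda>w. min (T x w) (T y w))" for x y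
  proof
    fix w
    have "inf x y = (x + y) - sup x y" by (metis add_diff_cancel_left' add_eq_inf_sup)
    then have "T (inf x y) w = T x w + T y w - max (T x w) (T y w)"
      by (simp only: diff add sup)
    then show "T (inf x y) w = min (T x w) (T y w)" by (simp add: max_def min_def)
  qed
  show ?thesis unfolding lattice_iso_c00_def using bij add scale sup inf by blast
qed

text \<open>A maximal disjoint set of atoms is a vector space basis, and positive elements are its
  nonnegative combinations. By uniqueness of coordinates the order is then coordinatewise.\<close>

lemma c00_iso_if_disjoint_finite:
  assumes nontrivial: "\<exists>x::'a::vector_lattice. x \<noteq> 0"
    and arch: "archimedean TYPE('a)" and df: "disjoint_finite TYPE('a)"
  obtains \<Omega> and T :: "'a::vector_lattice \<Rightarrow> 'a \<Rightarrow> real" where "\<Omega> \<noteq> {}" "lattice_iso_c00 \<Omega> T"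
proof -
  obtain \<Omega> :: "'a set" where \<Omega>: "\<And>a. a \<in> \<Omega> \<Longrightarrow> lattice_atom a" "pairwise (\<lambda>a b. inf a b = 0) \<Omega>"
    "\<And>b. lattice_atom b \<Longrightarrow> \<exists>a\<in>\<Omega>. \<exists>r. b = r *\<^sub>R a"
    using exists_disjoint_lattice_atoms by blast
  have pos: "0 < a" if "a \<in> \<Omega>" for a using \<Omega>(1)[OF that] by (simp add: lattice_atom_def)
  have indep: "independent \<Omega>" using pos \<Omega>(2) by (rule independent_if_disjoint)
  \<comment> \<open>A representation vanishes outside the basis, which matches the extension by zero
    in \<open>c00\<close>.\<close>
  define T where "T = representation \<Omega>"
  have combination: "x \<in> span \<Omega> \<and> T x = (\<lambda>a. if a \<in> F then c a else 0)"
    if "finite F" "F \<subseteq> \<Omega>" "x = (\<Sum>a\<in>F. c a *\<^sub>R a)" for F c x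
  proof
    show span: "x \<in> span \<Omega>"
      using that by (auto intro!: span_sum span_scale intro: span_base)
    show "T x = (\<lambda>a. if a \<in> F then c a else 0)"
      unfolding T_def
    proof (rule real_vector.representation_eqI[OF indep span])
      let ?f = "\<lambda>a. if a \<in> F then c a else 0"
      show "a \<in> \<Omega>" if "?f a \<noteq> 0" for a using that \<open>F \<subseteq> \<Omega>\<close> by (auto split: if_splits)
      have sub: "{a. ?f a \<noteq> 0} \<subseteq> F" by auto
      then show "finite {a. ?f a \<noteq> 0}" using \<open>finite F\<close> finite_subset by blast
      show "(\<Sum>a | ?f a \<noteq> 0. ?f a *\<^sub>R a) = x"
        unfolding that(3) using \<open>finite F\<close> sub by (intro sum.mono_neutral_cong_left) auto
    qed
  qed
  have nonneg_span: "x \<in> span \<Omega> \<and> (\<forall>a. 0 \<le> T x a)" if x: "0 \<le> x" for x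
  proof -
    obtain F c where F: "finite F" "F \<subseteq> \<Omega>" "\<And>a. 0 \<le> c a" "x = (\<Sum>a\<in>F. c a *\<^sub>R a)"
      using nonneg_eq_sum_atoms[OF arch df \<Omega> x] by blast
    show ?thesis using combination[OF F(1,2,4)] F(3) by simp
  qed
  have span: "x \<in> span \<Omega>" for x
  proof -
    \<comment> \<open>Only positive elements have been expanded so far; a general \<open>x\<close>
      is the difference of its positive part \<open>pprt x\<close> and
      \<open>- nprt x\<close>.\<close>
    have "pprt x \<in> span \<Omega>" "- nprt x \<in> span \<Omega>" using nonneg_span by simp_all
    then have "pprt x - (- nprt x) \<in> span \<Omega>" by (rule span_diff)
    then show ?thesis using prts[of x] by simp
  qed
  have expand: "(\<Sum>a | T x a \<noteq> 0. T x a *\<^sub>R a) = x" for x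
    unfolding T_def using indep span by (rule real_vector.sum_nonzero_representation_eq)
  have "lattice_iso_c00 \<Omega> T"
  proof (rule lattice_iso_c00I)
    show "T (x + y) = (\<lambda>w. T x w + T y w)" for x y
      unfolding T_def using indep span span by (rule real_vector.representation_add)
    show "T (r *\<^sub>R x) = (\<lambda>w. r * T x w)" for r x
      unfolding T_def using indep span by (rule real_vector.representation_scale)
    show "0 \<le> x \<longleftrightarrow> (\<forall>w. 0 \<le> T x w)" for x
    proof
      assume nn: "\<forall>w. 0 \<le> T x w"
      have "0 \<le> (\<Sum>a | T x a \<noteq> 0. T x a *\<^sub>R a)"
      proof (rule sum_nonneg)
        fix a assume "a \<in> {a. T x a \<noteq> 0}"
        then have "a \<in> \<Omega>" unfolding T_def by (auto dest: real_vector.representation_ne_zero)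
        then show "0 \<le> T x a *\<^sub>R a"
          using nn pos by (intro scaleR_nonneg_nonneg) (auto intro: less_imp_le)
      qed
      then show "0 \<le> x" by (simp only: expand)
    qed (use nonneg_span in blast)
    show "bij_betw T UNIV (c00 \<Omega>)"
    proof (rule bij_betw_imageI)
      show "inj T" by (rule injI) (metis expand)
      show "range T = c00 \<Omega>"
      proof (intro equalityI subsetI)
        fix f assume "f \<in> range T"
        then obtain x where "f = T x" by blast
        then show "f \<in> c00 \<Omega>"
          unfolding c00_def T_def
          using real_vector.finite_representation[of \<Omega> x] real_vector.representation_ne_zero[of \<Omega> x]
          by auto
      next
        fix f assume f: "f \<in> c00 \<Omega>"
        let ?F = "{a. f a \<noteq> 0}"
        have "finite ?F" "?F \<subseteq> \<Omega>" using f by (auto simp: c00_def)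
        from combination[OF this refl, of f] have "T (\<Sum>a\<in>?F. f a *\<^sub>R a) = f" by auto
        then show "f \<in> range T" by (metis rangeI)
      qed
    qed
  qed
  moreover have "\<Omega> \<noteq> {}"
  proof
    assume "\<Omega> = {}"
    then show False using nontrivial span by simp
  qed
  ultimately show thesis using that by blast
qed

section \<open>Prime ideals of finitely supported functions\<close>

lemma lattice_iso_c00_indicator:
  assumes "lattice_iso_c00 \<Omega> T" "w \<in> \<Omega>"
  obtains e where "T e = (\<lambda>v. if v = w then 1 else 0)"
proof -
  have "(\<lambda>v. if v = w then 1 else 0) \<in> c00 \<Omega>" using assms(2) by (auto simp: c00_def)
  also have "c00 \<Omega> = range T" using assms(1) by (simp add: lattice_iso_c00_def bij_betw_def)
  finally show thesis using that by (auto simp: image_iff)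
qed

text \<open>A prime ideal of \<open>c\<^sub>0\<^sub>0(\<Omega>)\<close> misses the indicator of some point \<open>w\<close>; every function vanishing
  at \<open>w\<close> is disjoint from that indicator, hence lies in the ideal.\<close>

lemma c00_prime_order_ideal:
  fixes T :: "'a::vector_lattice \<Rightarrow> 'b \<Rightarrow> real"
  assumes iso: "lattice_iso_c00 \<Omega> T" and P: "prime_order_ideal P"
  obtains w where "w \<in> \<Omega>" "P = {x. T x w = 0}"
proof -
  have bij: "bij_betw T UNIV (c00 \<Omega>)"
    and add: "T (x + y) = (\<lambda>w. T x w + T y w)"
    and scale: "T (r *\<^sub>R x) = (\<lambda>w. r * T x w)"
    and sup: "T (sup x y) = (\<lambda>w. max (T x w) (T y w))"
    and inf: "T (inf x y) = (\<lambda>w. min (T x w) (T y w))" for x y r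
    using iso by (auto simp: lattice_iso_c00_def)
  have oi: "order_ideal P" using P by (simp add: prime_order_ideal_def)
  note sub = order_ideal_subspace[OF oi]
  have inj: "x = y" if "T x = T y" for x y using bij that by (auto simp: bij_betw_def inj_def)
  have zero: "T 0 w = 0" for w using scale[of 0 0] by simp
  have neg: "T (- x) w = - T x w" for x w using scale[of "-1" x] by simp
  have abs: "T \<bar>x\<bar> w = \<bar>T x w\<bar>" for x w by (simp add: abs_lattice sup neg sup_max)
  have c00: "T x \<in> c00 \<Omega>" for x using bij by (auto simp: bij_betw_def)
  have fin: "finite {w. T x w \<noteq> 0}" for x using c00[of x] by (simp add: c00_def)
  define n where "n x = card {w. T x w \<noteq> 0}" for x
  have "\<exists>x. x \<notin> P" using P by (auto simp: prime_order_ideal_def)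
  \<comment> \<open>The point \<open>w\<close> is taken from the support of an element outside
    \<open>P\<close> with smallest support. Were the indicator of \<open>w\<close> in
    \<open>P\<close>, deleting \<open>w\<close> from this support would give an element of
    \<open>P\<close>, and adding back a multiple of the indicator would put \<open>x\<close> in
    \<open>P\<close>.\<close>
  then obtain x where x: "x \<notin> P" and min: "\<And>y. y \<notin> P \<Longrightarrow> n x \<le> n y"
    using ex_has_least_nat[of "\<lambda>x. x \<notin> P" _ n] by blast
  have "\<exists>w. T x w \<noteq> 0"
  proof (rule ccontr)
    assume "\<not> ?thesis"
    then have "x = 0" by (intro inj) (simp add: zero fun_eq_iff)
    then show False using x subspace_0[OF sub] by simp
  qed
  then obtain w where w: "T x w \<noteq> 0" by blast
  then have w\<Omega>: "w \<in> \<Omega>" using c00[of x] by (auto simp: c00_def)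
  then obtain e where e: "T e = (\<lambda>v. if v = w then 1 else 0)"
    using lattice_iso_c00_indicator[OF iso] by blast
  have eP: "e \<notin> P"
  proof
    assume eP: "e \<in> P"
    define y where "y = x + (- T x w) *\<^sub>R e"
    have Ty: "T y = (\<lambda>v. if v = w then 0 else T x v)"
      unfolding y_def add scale e by auto
    have "{v. T y v \<noteq> 0} \<subset> {v. T x v \<noteq> 0}" using w by (auto simp: Ty)
    then have "n y < n x" unfolding n_def by (rule psubset_card_mono[OF fin])
    then have "y \<in> P" using min[of y] by fastforce
    then have "y + T x w *\<^sub>R e \<in> P" using eP by (intro subspace_add[OF sub] subspace_scale[OF sub])
    then show False using x by (simp add: y_def)
  qed
  have "P = {x. T x w = 0}"
  proof (intro equalityI subsetI)
    fix y assume "y \<in> {y. T y w = 0}"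
    then have "inf \<bar>y\<bar> e = 0" by (intro inj) (auto simp: inf abs e zero fun_eq_iff)
    then have "\<bar>y\<bar> \<in> P"
      using P subspace_0[OF sub] eP unfolding prime_order_ideal_def by metis
    then show "y \<in> P" using order_ideal_abs_le[OF oi] by blast
  next
    fix y assume y: "y \<in> P"
    show "y \<in> {y. T y w = 0}"
    proof (rule ccontr)
      assume "y \<notin> {y. T y w = 0}"
      then have yw: "T y w \<noteq> 0" by simp
      \<comment> \<open>The scaling gives \<open>z\<close> the value 1 at \<open>w\<close>, so that
        \<open>z\<close> dominates the indicator \<open>e\<close>.\<close>
      define z where "z = inverse \<bar>T y w\<bar> *\<^sub>R \<bar>y\<bar>"
      have "z \<in> P" unfolding z_def using y by (intro subspace_scale[OF sub] order_ideal_abs[OF oi])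
      moreover have "inf e z = e" using yw by (intro inj) (auto simp: inf e z_def scale abs fun_eq_iff)
      moreover have "\<bar>e\<bar> = e" by (intro inj) (auto simp: abs e fun_eq_iff)
      ultimately have "e \<in> P" using order_ideal_abs_le[OF oi] by (metis inf.cobounded2)
      then show False using eP by simp
    qed
  qed
  then show thesis using that w\<Omega> by blast
qed

text \<open>Kernels of evaluations at different points are incomparable: the indicator of
  \<open>w 0\<close> vanishes at any other point but not at \<open>w 0\<close>. A decreasing
  sequence of prime ideals is therefore constant.\<close>

lemma c00_prime_artinian:
  fixes T :: "'a::vector_lattice \<Rightarrow> 'b \<Rightarrow> real"
  assumes iso: "lattice_iso_c00 \<Omega> T"
  shows "prime_artinian TYPE('a)"
  unfolding prime_artinian_def
proof (intro allI impI)
  fix P :: "nat \<Rightarrow> 'a set"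
  assume prime: "\<forall>n. prime_order_ideal (P n)" and dec: "decseq P"
  have "\<forall>n. \<exists>w. w \<in> \<Omega> \<and> P n = {x. T x w = 0}"
    using c00_prime_order_ideal[OF iso] prime by metis
  then obtain w where w: "\<And>n. w n \<in> \<Omega>" "\<And>n. P n = {x. T x (w n) = 0}" by metis
  have "w n = w 0" for n
  proof (rule ccontr)
    assume ne: "w n \<noteq> w 0"
    obtain e where e: "T e = (\<lambda>v. if v = w 0 then 1 else 0)"
      using lattice_iso_c00_indicator[OF iso w(1)] by blast
    have "e \<in> P n" using ne e by (simp add: w(2))
    then have "e \<in> P 0" using decseqD[OF dec, of 0 n] by blast
    then show False using e by (simp add: w(2))
  qed
  then have "P n = P 0" for n unfolding w(2) by metis
  then show "\<exists>k. \<forall>n\<ge>k. P n = P k" by blast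
qed

theorem theorem7p2:
  assumes nontrivial: "\<exists>x::'a::vector_lattice. x \<noteq> 0"
    and archimedean: "archimedean TYPE('a)"
    and complete: "uniformly_complete TYPE('a)"
  shows "prime_artinian TYPE('a) \<longleftrightarrow>
    (\<exists>(\<Omega> :: 'a set) T. \<Omega> \<noteq> {} \<and> lattice_iso_c00 \<Omega> (T :: 'a \<Rightarrow> 'a \<Rightarrow> real))"
proof
  assume "prime_artinian TYPE('a)"
  then have "disjoint_finite TYPE('a)"
    by (rule disjoint_finite_if_prime_artinian[OF archimedean complete])
  then obtain \<Omega> and T :: "'a \<Rightarrow> 'a \<Rightarrow> real" where "\<Omega> \<noteq> {}" "lattice_iso_c00 \<Omega> T"
    by (rule c00_iso_if_disjoint_finite[OF nontrivial archimedean])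
  then show "\<exists>(\<Omega> :: 'a set) T. \<Omega> \<noteq> {} \<and> lattice_iso_c00 \<Omega> (T :: 'a \<Rightarrow> 'a \<Rightarrow> real)"
    by blast
next
  assume "\<exists>(\<Omega> :: 'a set) T. \<Omega> \<noteq> {} \<and> lattice_iso_c00 \<Omega> (T :: 'a \<Rightarrow> 'a \<Rightarrow> real)"
  then show "prime_artinian TYPE('a)" using c00_prime_artinian by blast
qed

end
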